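(* Let $\frac n2+\frac12<\alpha<\frac n2+1$ and let $$\mathbf{W}_\alpha(t,x)=\int_{\mathbb{R}_+\times\mathbf{H}^n}\mathbf{1}_{[0,t]}(r)\,\big(G_\alpha(x,q)-G_\alpha(e,q)\big)\,dW_{\mathbf{H}^n}(r,q),\qquad t\ge0,\ x\in\mathbf{H}^n.$$ Then for every $\theta\in[0,2\pi)$, $$\mathbf{W}_\alpha(t,R_\theta(x))\stackrel{\mathcal{D}}{=}\mathbf{W}_\alpha(t,x)\qquad\text{for all }(t,x)\in\mathbb{R}_+\times\mathbf{H}^n.$$
   Context: Let $n\ge1$. The Heisenberg group $\mathbf{H}^n$ is $\mathbb{R}^n\times\mathbb{R}^n\times\mathbb{R}$ with product $(x,y,z)\star(x',y',z')=(x+x',y+y',z+z'+2\sum_{i=1}^n(x_i'y_i-x_iy_i'))$ and identity $e=(0,0,0)$; $\mu$ is Lebesgue measure on $\mathbb{R}^{2n+1}$. Let $X_i=\partial_{x_i}+2y_i\partial_z$, $Y_i=\partial_{y_i}-2x_i\partial_z$ and $\Delta=\sum_{i=1}^n(X_i^2+Y_i^2)$ (self-adjoint on $L^2(\mathbf{H}^n,\mu)$). For $0<\alpha<n+1$, $G_\alpha(q_1,q_2)=\frac{1}{\Gamma(\alpha)}\int_0^\infty t^{\alpha-1}h_t(q_1^{-1}q_2)\,dt$ is the integral kernel of $(-\Delta)^{-\alpha}$, where $h_t(q_1^{-1}q_2)$ is the kernel (w.r.t. $\mu$) of $e^{t\Delta}$. For $\frac{n+1}2<\alpha<\frac n2+1$,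 $G_\alpha(x,\cdot)-G_\alpha(e,\cdot)\in L^2(\mathbf{H}^n,\mu)$ for every $x\in\mathbf{H}^n$. $W_{\mathbf{H}^n}$ is a white noise on $\mathbb{R}_+\times\mathbf{H}^n$, i.e. a centered Gaussian family indexed by $L^2(\mathbb{R}_+\times\mathbf{H}^n;dt\otimes\mu)$ with covariance $\int_{\mathbb{R}_+\times\mathbf{H}^n}f\,g\,d\mu\,dt$. The horizontal rotation is $R_\theta(x,y,z)=((\cos\theta)x+(\sin\theta)y,\,-(\sin\theta)x+(\cos\theta)y,\,z)$ for $x,y\in\mathbb{R}^n$, $z\in\mathbb{R}$. $\stackrel{\mathcal{D}}{=}$ denotes equality in law. *)

theory Defs
  imports "HOL-Probability.Probability"
begin

text \<open>The group of index \<open>n = CARD('n)\<close>; Lebesgue measure on it is \<^const>\<open>lborel\<close>.\<close>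

type_synonym 'n heis = "(real ^ 'n) \<times> (real ^ 'n) \<times> real"

definition heis_mult :: "'n::finite heis \<Rightarrow> 'n heis \<Rightarrow> 'n heis" (infixl \<open>\<star>\<close> 70) where
  "p \<star> q = (case (p, q) of ((x, y, z), (x', y', z')) \<Rightarrow>
     (x + x', y + y', z + z' + 2 * (\<Sum>i\<in>UNIV. x' $ i * y $ i - x $ i * y' $ i)))"

definition heis_e :: "'n::finite heis" where
  "heis_e = (0, 0, 0)"

definition heis_inv :: "'n::finite heis \<Rightarrow> 'n heis" where
  "heis_inv p = (case p of (x, y, z) \<Rightarrow> (- x, - y, - z))"

lemma heis_mult_assoc: "(p \<star> q) \<star> r = p \<star> (q \<star> r)"
  by (cases p; cases q; cases r)
    (simp add: heis_mult_def algebra_simps sum.distrib sum_subtractf)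

lemma heis_e_left: "heis_e \<star> p = p"
  by (cases p) (simp add: heis_mult_def heis_e_def)

lemma heis_e_right: "p \<star> heis_e = p"
  by (cases p) (simp add: heis_mult_def heis_e_def)

lemma heis_inv_left: "heis_inv p \<star> p = heis_e"
  by (cases p) (simp add: heis_mult_def heis_e_def heis_inv_def algebra_simps)

lemma heis_inv_right: "p \<star> heis_inv p = heis_e"
  by (cases p) (simp add: heis_mult_def heis_e_def heis_inv_def algebra_simps)

definition heis_rot :: "real \<Rightarrow> 'n::finite heis \<Rightarrow> 'n heis" where
  "heis_rot \<theta> p = (case p of (x, y, z) \<Rightarrow>
     (cos \<theta> *\<^sub>R x + sin \<theta> *\<^sub>R y, - sin \<theta> *\<^sub>R x + cos \<theta> *\<^sub>R y, z))"

text \<open>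
  Elements of \<open>L\<^sup>2\<close> are represented by functions; identities between them
  are understood almost everywhere.
\<close>

definition L2 :: "'a measure \<Rightarrow> ('a \<Rightarrow> real) set" where
  "L2 M = {f \<in> borel_measurable M. integrable M (\<lambda>x. (f x)\<^sup>2)}"

definition L2_dist :: "'a measure \<Rightarrow> ('a \<Rightarrow> real) \<Rightarrow> ('a \<Rightarrow> real) \<Rightarrow> real" where
  "L2_dist M f g = sqrt (\<integral>x. (f x - g x)\<^sup>2 \<partial>M)"

definition contraction_semigroup ::
    "'a measure \<Rightarrow> (real \<Rightarrow> ('a \<Rightarrow> real) \<Rightarrow> ('a \<Rightarrow> real)) \<Rightarrow> bool" where
  "contraction_semigroup M T \<longleftrightarrow>
     (\<forall>t\<ge>0. \<forall>f\<in>L2 M. T t f \<in> L2 M) \<and>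
     (\<forall>t\<ge>0. \<forall>f\<in>L2 M. \<forall>g\<in>L2 M. \<forall>a b. AE x in M.
        T t (\<lambda>y. a * f y + b * g y) x = a * T t f x + b * T t g x) \<and>
     (\<forall>t\<ge>0. \<forall>f\<in>L2 M. L2_dist M (T t f) (\<lambda>_. 0) \<le> L2_dist M f (\<lambda>_. 0)) \<and>
     (\<forall>f\<in>L2 M. AE x in M. T 0 f x = f x) \<and>
     (\<forall>s\<ge>0. \<forall>t\<ge>0. \<forall>f\<in>L2 M. AE x in M. T (s + t) f x = T s (T t f) x) \<and>
     (\<forall>f\<in>L2 M. ((\<lambda>t. L2_dist M (T t f) f) \<longlongrightarrow> 0) (at_right 0))"

text \<open>Unbounded operators are given by their graphs.\<close>

definition generator ::
    "'a measure \<Rightarrow> (real \<Rightarrow> ('a \<Rightarrow> real) \<Rightarrow> ('a \<Rightarrow> real)) \<Rightarrow> (('a \<Rightarrow> real) \<times> ('a \<Rightarrow> real)) set" where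
  "generator M T = {(f, g). f \<in> L2 M \<and> g \<in> L2 M \<and>
     ((\<lambda>t. L2_dist M (\<lambda>x. (T t f x - f x) / t) g) \<longlongrightarrow> 0) (at_right 0)}"

definition dir_deriv :: "'a::real_normed_vector \<Rightarrow> ('a \<Rightarrow> real) \<Rightarrow> 'a \<Rightarrow> real" where
  "dir_deriv v f q = frechet_derivative f (at q) v"

text \<open>
  A function is \<open>C\<^sup>\<infinity>\<close> if all its iterated directional derivatives exist and are
  differentiable (hence continuous).
\<close>

definition smooth :: "('a::real_normed_vector \<Rightarrow> real) \<Rightarrow> bool" where
  "smooth f \<longleftrightarrow> (\<forall>vs q. foldr dir_deriv vs f differentiable (at q))"

definition test_functions :: "('a::real_normed_vector \<Rightarrow> real) set" where
  "test_functions = {f. smooth f \<and> compact (closure {q. f q \<noteq> 0})}"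

definition X_field :: "'n::finite \<Rightarrow> ('n heis \<Rightarrow> real) \<Rightarrow> 'n heis \<Rightarrow> real" where
  "X_field i f = (\<lambda>(x, y, z).
     dir_deriv (axis i 1, 0, 0) f (x, y, z) + 2 * y $ i * dir_deriv (0, 0, 1) f (x, y, z))"

definition Y_field :: "'n::finite \<Rightarrow> ('n heis \<Rightarrow> real) \<Rightarrow> 'n heis \<Rightarrow> real" where
  "Y_field i f = (\<lambda>(x, y, z).
     dir_deriv (0, axis i 1, 0) f (x, y, z) - 2 * x $ i * dir_deriv (0, 0, 1) f (x, y, z))"

definition sublaplacian :: "('n::finite heis \<Rightarrow> real) \<Rightarrow> 'n heis \<Rightarrow> real" where
  "sublaplacian f q = (\<Sum>i\<in>UNIV. X_field i (X_field i f) q + Y_field i (Y_field i f) q)"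

text \<open>
  The self-adjoint realisation of the sub-Laplacian on \<open>L\<^sup>2\<close>: the closure of its restriction to
  compactly supported smooth functions, on which it is essentially self-adjoint.
\<close>

definition sublaplacian_L2 :: "(('n::finite heis \<Rightarrow> real) \<times> ('n heis \<Rightarrow> real)) set" where
  "sublaplacian_L2 = {(f, g). f \<in> L2 lborel \<and> g \<in> L2 lborel \<and>
     (\<exists>\<phi>. (\<forall>k. \<phi> k \<in> test_functions) \<and>
        (\<lambda>k. L2_dist lborel (\<phi> k) f) \<longlonglongrightarrow> 0 \<and>
        (\<lambda>k. L2_dist lborel (sublaplacian (\<phi> k)) g) \<longlonglongrightarrow> 0)}"

text \<open>
  The operators \<open>e\<^sup>t\<^sup>\<Delta>\<close> form the contraction semigroup \<open>T\<close> generated by the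
  self-adjoint sub-Laplacian, and \<open>h t (q\<inverse> \<star> q')\<close> is their integral kernel.
  This determines \<open>h\<close> up to a null set of \<open>(0,\<infinity>) \<times> 'n heis\<close>; values of \<open>h\<close> at nonpositive times are
  irrelevant.
\<close>

definition heat_kernel :: "(real \<Rightarrow> 'n::finite heis \<Rightarrow> real) \<Rightarrow> bool" where
  "heat_kernel h \<longleftrightarrow>
     (\<lambda>(t, q). h t q) \<in> borel_measurable (restrict_space lborel {0<..} \<Otimes>\<^sub>M lborel) \<and>
     (\<exists>T. contraction_semigroup lborel T \<and> generator lborel T = sublaplacian_L2 \<and>
        (\<forall>t>0. \<forall>f\<in>L2 lborel. AE q in lborel.
           integrable lborel (\<lambda>q'. h t (heis_inv q \<star> q') * f q') \<and>
           T t f q = (\<integral>q'. h t (heis_inv q \<star> q') * f q' \<partial>lborel)))"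

text \<open>
  Where the integral diverges (as on the diagonal), the value is the conventional \<open>0\<close>;
  only the values for almost every \<open>q\<^sub>2\<close> matter below.
\<close>

definition G_kernel :: "(real \<Rightarrow> 'n::finite heis \<Rightarrow> real) \<Rightarrow> real \<Rightarrow> 'n heis \<Rightarrow> 'n heis \<Rightarrow> real" where
  "G_kernel h \<alpha> q\<^sub>1 q\<^sub>2 =
     1 / Gamma \<alpha> * (LINT t:{0<..}|lborel. t powr (\<alpha> - 1) * h t (heis_inv q\<^sub>1 \<star> q\<^sub>2))"

definition centered_gaussian :: "'w measure \<Rightarrow> ('w \<Rightarrow> real) \<Rightarrow> bool" where
  "centered_gaussian M X \<longleftrightarrow> X \<in> borel_measurable M \<and>
     ((AE \<omega> in M. X \<omega> = 0) \<or> (\<exists>\<sigma>>0. distributed M lborel X (normal_density 0 \<sigma>)))"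

definition spacetime :: "(real \<times> 'n::finite heis) measure" where
  "spacetime = restrict_space lborel {0..} \<Otimes>\<^sub>M lborel"

definition white_noise ::
    "'w measure \<Rightarrow> ((real \<times> 'n::finite heis \<Rightarrow> real) \<Rightarrow> 'w \<Rightarrow> real) \<Rightarrow> bool" where
  "white_noise M W \<longleftrightarrow> prob_space M \<and>
     (\<forall>F c. finite F \<and> F \<subseteq> L2 spacetime \<longrightarrow> centered_gaussian M (\<lambda>\<omega>. \<Sum>f\<in>F. c f * W f \<omega>)) \<and>
     (\<forall>f\<in>L2 spacetime. \<forall>g\<in>L2 spacetime.
        (\<integral>\<omega>. W f \<omega> * W g \<omega> \<partial>M) = (\<integral>p. f p * g p \<partial>spacetime))"

text \<open>
  The stochastic integral of a square-integrable deterministic integrand against the white noise;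
  as for the Bochner integral, other integrands get the conventional value \<open>0\<close>.
\<close>

definition wiener_integral ::
    "((real \<times> 'n::finite heis \<Rightarrow> real) \<Rightarrow> 'w \<Rightarrow> real) \<Rightarrow> (real \<times> 'n heis \<Rightarrow> real) \<Rightarrow> 'w \<Rightarrow> real" where
  "wiener_integral W f = (if f \<in> L2 spacetime then W f else (\<lambda>_. 0))"

definition W_field ::
    "(real \<Rightarrow> 'n::finite heis \<Rightarrow> real) \<Rightarrow> ((real \<times> 'n heis \<Rightarrow> real) \<Rightarrow> 'w \<Rightarrow> real) \<Rightarrow>
     real \<Rightarrow> real \<Rightarrow> 'n heis \<Rightarrow> 'w \<Rightarrow> real" where
  "W_field h W \<alpha> t x =
     wiener_integral W (\<lambda>(r, q). indicator {0..t} r * (G_kernel h \<alpha> x q - G_kernel h \<alpha> heis_e q))"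

lemma white_noise_measurable:
  assumes "white_noise M W" and f: "f \<in> L2 spacetime"
  shows "W f \<in> borel_measurable M"
proof -
  have gauss: "\<forall>F c. finite F \<and> F \<subseteq> L2 spacetime \<longrightarrow>
      centered_gaussian M (\<lambda>\<omega>. \<Sum>f\<in>F. c f * W f \<omega>)"
    using assms(1) unfolding white_noise_def by (elim conjE)
  have "centered_gaussian M (\<lambda>\<omega>. \<Sum>f\<in>{f}. 1 * W f \<omega>)"
    using f by (intro gauss[THEN spec, THEN spec, THEN mp, of "{f}" "\<lambda>_. 1"]) simp
  then show ?thesis
    by (simp add: centered_gaussian_def)
qed

lemma W_field_measurable:
  assumes "white_noise M W"
  shows "W_field h W \<alpha> t x \<in> borel_measurable M"
proof (cases "(\<lambda>(r, q). indicator {0..t} r * (G_kernel h \<alpha> x q - G_kernel h \<alpha> heis_e q)) \<in> L2 spacetime")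
  case True
  then show ?thesis
    unfolding W_field_def wiener_integral_def if_P[OF True]
    by (rule white_noise_measurable[OF assms])
next
  case False
  show ?thesis
    unfolding W_field_def wiener_integral_def if_not_P[OF False] by (rule measurable_const) simp
qed

text \<open>
  Equality in law of two random fields indexed by \<open>I\<close> (equality of all finite-dimensional
  distributions); it includes equality in law of the values at each index.
\<close>

definition equal_in_law ::
    "'w measure \<Rightarrow> 'i set \<Rightarrow> ('i \<Rightarrow> 'w \<Rightarrow> real) \<Rightarrow> ('i \<Rightarrow> 'w \<Rightarrow> real) \<Rightarrow> bool" where
  "equal_in_law M I X Y \<longleftrightarrow>
     (\<forall>J. finite J \<and> J \<subseteq> I \<longrightarrow>
        distr M (\<Pi>\<^sub>M j\<in>J. borel) (\<lambda>\<omega>. \<lambda>j\<in>J. X j \<omega>) = distr M (\<Pi>\<^sub>M j\<in>J. borel) (\<lambda>\<omega>. \<lambda>j\<in>J. Y j \<omega>))"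

lemma equal_in_lawD:
  assumes "equal_in_law M I X Y" and i: "i \<in> I"
    and [measurable]: "X i \<in> borel_measurable M" "Y i \<in> borel_measurable M"
  shows "distr M borel (X i) = distr M borel (Y i)"
proof -
  let ?P = "\<Pi>\<^sub>M j\<in>{i}. (borel :: real measure)"
  have one: "distr M borel (Z i) = distr (distr M ?P (\<lambda>\<omega>. \<lambda>j\<in>{i}. Z j \<omega>)) borel (\<lambda>u. u i)"
    if [measurable]: "Z i \<in> borel_measurable M" for Z
  proof -
    have [measurable]: "(\<lambda>\<omega>. \<lambda>j\<in>{i}. Z j \<omega>) \<in> measurable M ?P"
      by (rule measurable_restrict) auto
    have [measurable]: "(\<lambda>u. u i) \<in> borel_measurable ?P"
      by (rule measurable_component_singleton) simp
    show ?thesis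
      by (subst distr_distr) (auto simp: comp_def)
  qed
  have "distr M ?P (\<lambda>\<omega>. \<lambda>j\<in>{i}. X j \<omega>) = distr M ?P (\<lambda>\<omega>. \<lambda>j\<in>{i}. Y j \<omega>)"
    using assms(1) i unfolding equal_in_law_def by (metis empty_subsetI finite.emptyI finite.insertI insert_subset)
  then show ?thesis
    using one[of X] one[of Y] by simp
qed

end

theory Submission
  imports Defs
begin

text \<open>
  Two facts give the result. First, the rotation \<open>R\<close> is a measure-preserving group automorphism
  commuting with the sub-Laplacian on test functions, so \<open>T\<^sub>t\<close> and its conjugate by \<open>R\<close> are contraction
  semigroups with the same generator; they agree on test functions, their kernels agree almost
  everywhere, and hence \<open>G\<^sub>\<alpha>(R x, R q) = G\<^sub>\<alpha>(x, q)\<close> for almost every \<open>q\<close>. Second, the finite-dimensional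
  laws of a Gaussian family are determined by its covariances, which for the two fields are the
  \<open>L\<^sup>2\<close> products of their integrands and are therefore equal after the substitution \<open>q \<mapsto> R q\<close>.
\<close>

section \<open>Smooth functions\<close>

text \<open>\<open>h\<close> is not given by a formula: \<open>heat_kernel\<close> knows it only
  through the operators with kernel \<open>h t (heis_inv q \<star> q')\<close>. Its invariance has
  to come from uniqueness of the semigroup with a given generator and be read off by testing. Each
  test function yields an identity for almost every \<open>q\<close>, with a null set that depends
  on the test function. Hence the detour over bump functions on boxes with rational corners:
  countably many identities hold at one common \<open>q\<close>, they determine the kernel in
  \<open>q'\<close> almost everywhere, and a left translation removes \<open>q\<close>. The null set
  still depends on \<open>t\<close>, so Fubini is applied once more before the time integrals in
  \<open>G_kernel\<close> are compared.

  On the probabilistic side, joint laws are reduced to uniqueness of one-dimensional characteristic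
  functions by turning exponentials into indicators one coordinate at a time.\<close>

lemma dir_deriv_eq:
  "(f has_derivative f') (at q) \<Longrightarrow> dir_deriv v f q = f' v"
  unfolding dir_deriv_def using frechet_derivative_at by metis

lemma has_derivative_dir_deriv:
  "f differentiable (at q) \<Longrightarrow> (f has_derivative (\<lambda>v. dir_deriv v f q)) (at q)"
  unfolding dir_deriv_def by (simp add: frechet_derivative_works)

text \<open>Closure under a single derivative replaces explicit formulas for iterated ones. Each
  smoothness proof below consists in choosing a class \<open>C\<close> that the differentiation rule
  maps into itself.\<close>

lemma smooth_coinduct:
  assumes "f \<in> C" and diff: "\<And>g q. g \<in> C \<Longrightarrow> g differentiable (at q)"
    and step: "\<And>g v. g \<in> C \<Longrightarrow> dir_deriv v g \<in> C"
  shows "smooth f"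
proof -
  have "foldr dir_deriv vs f \<in> C" for vs
    by (induction vs) (use assms in auto)
  then show ?thesis
    unfolding smooth_def using diff by blast
qed

lemma smooth_differentiable: "smooth f \<Longrightarrow> f differentiable (at q)"
  unfolding smooth_def by (metis foldr_Nil id_apply)

lemma smooth_has_derivative: "smooth f \<Longrightarrow> (f has_derivative (\<lambda>v. dir_deriv v f q)) (at q)"
  by (simp add: smooth_differentiable has_derivative_dir_deriv)

lemma smooth_dir_deriv: "smooth f \<Longrightarrow> smooth (dir_deriv v f)"
  unfolding smooth_def
proof safe
  fix vs q assume *: "\<forall>vs q. foldr dir_deriv vs f differentiable at q"
  show "foldr dir_deriv vs (dir_deriv v f) differentiable at q"
    using *[rule_format, of "vs @ [v]" q] by simp
qed

lemma smooth_continuous_on: "smooth f \<Longrightarrow> continuous_on S f"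
  by (meson continuous_at_imp_continuous_on differentiable_imp_continuous_within smooth_differentiable)

lemma smooth_const: "smooth (\<lambda>q. c)"
proof (rule smooth_coinduct[where C = "range (\<lambda>c q. c)"])
  show "dir_deriv v g \<in> range (\<lambda>c q. c)" if "g \<in> range (\<lambda>c q. c)" for g :: "'a \<Rightarrow> real" and v
    using that by (auto simp: dir_deriv_def fun_eq_iff)
qed auto

text \<open>The Leibniz rule turns a product into a sum of two products, so products alone are not
  closed under derivatives; products together with their finite sums are.\<close>

inductive_set smooth_products :: "('a::real_normed_vector \<Rightarrow> real) set" where
  mult: "smooth f \<Longrightarrow> smooth g \<Longrightarrow> (\<lambda>q. f q * g q) \<in> smooth_products"
| add: "f \<in> smooth_products \<Longrightarrow> g \<in> smooth_products \<Longrightarrow> (\<lambda>q. f q + g q) \<in> smooth_products"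

lemma smooth_products_differentiable: "f \<in> smooth_products \<Longrightarrow> f differentiable (at q)"
  by (induction rule: smooth_products.induct)
    (blast intro: differentiable_mult differentiable_add smooth_differentiable)+

lemma smooth_products_smooth:
  assumes "f \<in> smooth_products"
  shows "smooth f"
proof (rule smooth_coinduct[OF assms])
  show "dir_deriv v g \<in> smooth_products" if "g \<in> smooth_products" for g :: "'a \<Rightarrow> real" and v
    using that
  proof induction
    case (mult f g)
    have "dir_deriv v (\<lambda>q. f q * g q) = (\<lambda>q. f q * dir_deriv v g q + dir_deriv v f q * g q)"
      using mult by (auto intro!: dir_deriv_eq has_derivative_mult smooth_has_derivative)
    then show ?case
      using mult by (auto intro!: smooth_products.intros smooth_dir_deriv)
  next
    case (add f g)
    have "dir_deriv v (\<lambda>q. f q + g q) = (\<lambda>q. dir_deriv v f q + dir_deriv v g q)"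
      using add by (auto intro!: dir_deriv_eq has_derivative_add has_derivative_dir_deriv
        smooth_products_differentiable)
    then show ?case
      using add by (auto intro!: smooth_products.intros)
  qed
qed (rule smooth_products_differentiable)

lemma smooth_mult: "smooth f \<Longrightarrow> smooth g \<Longrightarrow> smooth (\<lambda>q. f q * g q)"
  by (rule smooth_products_smooth[OF smooth_products.mult])

lemma smooth_add:
  assumes "smooth f" "smooth g"
  shows "smooth (\<lambda>q. f q + g q)"
proof -
  \<comment> \<open>The factors 1 make each summand a product, so the closure result for
    \<open>smooth_products\<close> also covers plain sums.\<close>
  have "(\<lambda>q. f q * 1 + g q * 1) \<in> smooth_products"
    using assms by (intro smooth_products.intros smooth_const)
  then show ?thesis
    by (auto dest: smooth_products_smooth)
qed

lemma smooth_prod: "(\<And>i. i \<in> I \<Longrightarrow> smooth (f i)) \<Longrightarrow> smooth (\<lambda>q. \<Prod>i\<in>I. f i q)"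
  by (induction I rule: infinite_finite_induct) (auto intro!: smooth_const smooth_mult)

lemma smooth_linear:
  assumes "bounded_linear f"
  shows "smooth f"
proof (rule smooth_coinduct[where C = "insert f (range (\<lambda>c q. c))"])
  have f: "(f has_derivative f) (at q)" for q
    using assms by (rule bounded_linear_imp_has_derivative)
  show "dir_deriv v g \<in> insert f (range (\<lambda>c q. c))" if "g \<in> insert f (range (\<lambda>c q. c))" for g v
  proof -
    have "dir_deriv v f = (\<lambda>_. f v)"
      by (intro ext dir_deriv_eq f)
    moreover have "dir_deriv v (\<lambda>_. c) = (\<lambda>_. 0)" for c
      by (simp add: dir_deriv_def fun_eq_iff)
    ultimately show ?thesis
      using that by auto
  qed
  show "g differentiable (at q)" if "g \<in> insert f (range (\<lambda>c q. c))" for g q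
    using that f by (auto simp: differentiable_def intro: exI[of _ "\<lambda>_. 0"])
qed auto

lemma dir_deriv_compose_affine:
  assumes "bounded_linear L" "f differentiable (at (L q + c))"
  shows "dir_deriv v (\<lambda>q. f (L q + c)) q = dir_deriv (L v) f (L q + c)"
proof (rule dir_deriv_eq)
  have "((\<lambda>q. L q + c) has_derivative L) (at q)"
    by (auto intro!: derivative_eq_intros bounded_linear_imp_has_derivative assms)
  from diff_chain_at[OF this has_derivative_dir_deriv[OF assms(2)]]
  show "((\<lambda>q. f (L q + c)) has_derivative (\<lambda>v. dir_deriv (L v) f (L q + c))) (at q)"
    by (simp add: comp_def)
qed

text \<open>The chain rule keeps the class of composites with a fixed affine map stable: only the
  direction changes, from \<open>v\<close> to \<open>L v\<close>.\<close>

lemma smooth_compose_affine: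
  assumes L: "bounded_linear L" and f: "smooth f"
  shows "smooth (\<lambda>q. f (L q + c))"
proof (rule smooth_coinduct[where C = "(\<lambda>g q. g (L q + c)) ` {g. smooth g}"])
  show "dir_deriv v g \<in> (\<lambda>g q. g (L q + c)) ` {g. smooth g}"
    if g: "g \<in> (\<lambda>g q. g (L q + c)) ` {g. smooth g}" for g v
  proof -
    from g obtain k where k: "smooth k" "g = (\<lambda>q. k (L q + c))"
      by auto
    have "dir_deriv v g = (\<lambda>q. dir_deriv (L v) k (L q + c))"
      unfolding k by (intro ext dir_deriv_compose_affine L smooth_differentiable k)
    then show ?thesis
      using smooth_dir_deriv[OF k(1), of "L v"] by auto
  qed
  show "g differentiable (at q)" if g: "g \<in> (\<lambda>g q. g (L q + c)) ` {g. smooth g}" for g q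
  proof -
    from g obtain k where k: "smooth k" "g = (\<lambda>q. k (L q + c))"
      by auto
    have "(k \<circ> (\<lambda>q. L q + c)) differentiable (at q)"
      by (intro differentiable_chain_at smooth_differentiable k differentiable_add
        bounded_linear_imp_differentiable L differentiable_const)
    then show ?thesis
      by (simp add: k comp_def)
  qed
qed (use f in auto)

section \<open>Bump functions\<close>

text \<open>The flat function exp(-1/x), extended by 0. The polynomial in 1/x is carried along
  because differentiation produces one, which makes the family closed under derivatives.\<close>

definition exp_flat :: "real poly \<Rightarrow> real \<Rightarrow> real" where
  "exp_flat p x = (if 0 < x then poly p (1 / x) * exp (- (1 / x)) else 0)"

lemma poly_times_exp_tendsto_0: "((\<lambda>y::real. poly p y * exp (- y)) \<longlongrightarrow> 0) at_top"
proof -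
  have "((\<lambda>y::real. \<Sum>i\<le>degree p. coeff p i * (y ^ i / exp y)) \<longlongrightarrow> (\<Sum>i\<le>degree p. coeff p i * 0)) at_top"
    by (intro tendsto_sum tendsto_mult tendsto_const tendsto_power_div_exp_0)
  also have "(\<lambda>y. \<Sum>i\<le>degree p. coeff p i * (y ^ i / exp y)) = (\<lambda>y. poly p y * exp (- y))"
    by (simp add: poly_altdef sum_distrib_right exp_minus divide_inverse mult.assoc)
  finally show ?thesis
    by simp
qed

lemma exp_flat_tendsto_0: "(exp_flat p \<longlongrightarrow> 0) (at 0)"
proof -
  have "((\<lambda>x. poly p (1 / x) * exp (- (1 / x))) \<longlongrightarrow> 0) (at_right (0::real))"
    using filterlim_compose[OF poly_times_exp_tendsto_0 filterlim_inverse_at_top_right]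
    by (simp add: inverse_eq_divide)
  then have "(exp_flat p \<longlongrightarrow> 0) (at_right 0)"
    by (rule Lim_transform_eventually) (auto simp: eventually_at_filter exp_flat_def)
  moreover have "(exp_flat p \<longlongrightarrow> 0) (at_left 0)"
    by (rule Lim_transform_eventually[OF tendsto_const]) (auto simp: eventually_at_filter exp_flat_def)
  ultimately show ?thesis
    by (simp add: filterlim_split_at)
qed

text \<open>With y = 1/x, the derivative of p(y) exp(-y) in y is (p' - p)(y) exp(-y), and dy/dx =
  -y^2; this gives the polynomial \<open>[:0, 0, 1:] * (p - pderiv p)\<close>.\<close>

lemma exp_flat_has_field_derivative:
  "(exp_flat p has_field_derivative exp_flat ([:0, 0, 1:] * (p - pderiv p)) x) (at x)"
proof (cases x "0 :: real" rule: linorder_cases)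
  case greater
  have "((\<lambda>x. poly p (1 / x) * exp (- (1 / x))) has_field_derivative
      exp_flat ([:0, 0, 1:] * (p - pderiv p)) x) (at x)"
    using greater by (auto intro!: derivative_eq_intros DERIV_chain2[OF poly_DERIV]
      simp: exp_flat_def field_simps power2_eq_square)
  then show ?thesis
    by (rule DERIV_cong_ev[THEN iffD1, rotated 3])
      (use greater in \<open>auto simp: exp_flat_def intro!: eventually_mono[OF eventually_nhds_in_open[of "{0<..}" x]]\<close>)
next
  case less
  have "((\<lambda>x. 0) has_field_derivative exp_flat ([:0, 0, 1:] * (p - pderiv p)) x) (at x)"
    using less by (simp add: exp_flat_def)
  then show ?thesis
    by (rule DERIV_cong_ev[THEN iffD1, rotated 3])
      (use less in \<open>auto simp: exp_flat_def intro!: eventually_mono[OF eventually_nhds_in_open[of "{..<0}" x]]\<close>)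
next
  case equal
  \<comment> \<open>At 0, dividing by \<open>h\<close> multiplies the polynomial by its variable
    1/h, so the difference quotient is again a flat function, namely that of
    \<open>[:0, 1:] * p\<close>.\<close>
  have "((\<lambda>h. (exp_flat p (0 + h) - exp_flat p 0) / h) \<longlongrightarrow> 0) (at 0)"
    by (rule Lim_transform_eventually[OF exp_flat_tendsto_0[of "[:0, 1:] * p"]])
      (auto simp: eventually_at_filter exp_flat_def)
  then show ?thesis
    by (simp add: DERIV_def equal exp_flat_def)
qed

lemma smooth_exp_flat: "smooth (exp_flat p)"
proof (rule smooth_coinduct[where C = "range exp_flat"])
  \<comment> \<open>The direction \<open>v\<close> is absorbed into the polynomial, so that the
    directional derivative is literally a member of the family.\<close>
  have *: "(exp_flat p has_derivative (\<lambda>v. exp_flat (smult v ([:0, 0, 1:] * (p - pderiv p))) x)) (at x)" for p x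
    using exp_flat_has_field_derivative[of p x] unfolding has_field_derivative_def
    by (rule has_derivative_eq_rhs) (auto simp: exp_flat_def fun_eq_iff)
  show "dir_deriv v g \<in> range exp_flat" if "g \<in> range exp_flat" for g v
  proof -
    from that obtain p where "g = exp_flat p" by auto
    then have "dir_deriv v g = exp_flat (smult v ([:0, 0, 1:] * (p - pderiv p)))"
      by (simp only:) (intro ext dir_deriv_eq *)
    then show ?thesis by blast
  qed
  show "g differentiable (at q)" if "g \<in> range exp_flat" for g q
    using that * by (auto simp: differentiable_def)
qed auto

text \<open>A product of one-dimensional cutoffs, one for each face of the box. The factor
  \<open>Suc n\<close> steepens them, so that the functions tend to the indicator of the open box;
  being positive, it leaves the set of zeros the same for every \<open>n\<close>.\<close>

definition bump :: "nat \<Rightarrow> 'a::euclidean_space \<Rightarrow> 'a \<Rightarrow> 'a \<Rightarrow> real" where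
  "bump n a b q = (\<Prod>i\<in>Basis. exp_flat 1 (real (Suc n) * (q \<bullet> i - a \<bullet> i)) * exp_flat 1 (real (Suc n) * (b \<bullet> i - q \<bullet> i)))"

lemma exp_flat_1_bounds: "0 \<le> exp_flat 1 x" "exp_flat 1 x \<le> 1"
  by (auto simp: exp_flat_def)

lemma exp_flat_1_eq_0_iff: "exp_flat 1 x = 0 \<longleftrightarrow> x \<le> 0"
  by (auto simp: exp_flat_def)

lemma smooth_bump: "smooth (bump n a b)"
proof -
  have 1: "smooth (\<lambda>q. exp_flat 1 (q \<bullet> (real (Suc n) *\<^sub>R i) + real (Suc n) * - (a \<bullet> i)))" for i
    by (rule smooth_compose_affine[OF bounded_linear_inner_left smooth_exp_flat])
  have 2: "smooth (\<lambda>q. exp_flat 1 (q \<bullet> (- real (Suc n) *\<^sub>R i) + real (Suc n) * (b \<bullet> i)))" for i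
    by (rule smooth_compose_affine[OF bounded_linear_inner_left smooth_exp_flat])
  show ?thesis
    unfolding bump_def
    using 1 2 by (intro smooth_prod smooth_mult) (simp_all add: algebra_simps)
qed

lemma bump_eq_0_iff: "bump n a b q = 0 \<longleftrightarrow> q \<notin> box a b"
  by (auto simp: bump_def exp_flat_1_eq_0_iff mem_box mult_le_0_iff not_le[symmetric] not_less)

text \<open>One bound for all \<open>n\<close>: it serves as the majorant when the bumps are
  replaced by the indicator of the box in an integral.\<close>

lemma bump_bounds: "0 \<le> bump n a b q" "bump n a b q \<le> indicator (box a b) q"
proof -
  show "0 \<le> bump n a b q"
    unfolding bump_def by (intro prod_nonneg mult_nonneg_nonneg ballI exp_flat_1_bounds)
  have "bump n a b q \<le> 1"
    unfolding bump_def by (intro prod_le_1 conjI mult_nonneg_nonneg mult_le_one exp_flat_1_bounds)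
  then show "bump n a b q \<le> indicator (box a b) q"
    using bump_eq_0_iff[of n a b q] by (auto simp: indicator_def)
qed

lemma bump_tendsto:
  fixes q :: "'a::euclidean_space"
  shows "(\<lambda>n. bump n a b q) \<longlonglongrightarrow> indicator (box a b) q"
proof (cases "q \<in> box a b")
  case True
  have "(\<lambda>n. exp_flat 1 (real (Suc n) * x)) \<longlonglongrightarrow> 1" if "0 < x" for x
  proof -
    have "(\<lambda>n. exp (- (inverse (real (Suc n)) * inverse x))) \<longlonglongrightarrow> exp (- (0 * inverse x))"
      by (intro tendsto_intros LIMSEQ_inverse_real_of_nat)
    moreover have "exp_flat 1 (real (Suc n) * x) = exp (- (inverse (real (Suc n)) * inverse x))" for n
      using that by (simp add: exp_flat_def zero_less_mult_iff del: of_nat_Suc) (simp add: divide_inverse)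
    ultimately show ?thesis
      by simp
  qed
  then have "(\<lambda>n. bump n a b q) \<longlonglongrightarrow> (\<Prod>i\<in>(Basis::'a set). 1 * 1)"
    using True unfolding bump_def by (intro tendsto_prod tendsto_mult) (auto simp: mem_box)
  then show ?thesis
    using True by simp
next
  case False
  then have "bump n a b q = 0" for n
    by (simp add: bump_eq_0_iff)
  then show ?thesis using False by simp
qed

section \<open>Test functions\<close>

lemma test_functionsI:
  assumes "smooth f" "{q. f q \<noteq> 0} \<subseteq> K" "compact K"
  shows "f \<in> test_functions"
proof -
  have "closure {q. f q \<noteq> 0} \<subseteq> K"
    using assms by (intro closure_minimal compact_imp_closed)
  then have "compact (closure {q. f q \<noteq> 0})"
    using compact_Int_closed[OF assms(3) closed_closure[of "{q. f q \<noteq> 0}"]] by (simp add: inf.absorb2)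
  with assms(1) show ?thesis
    by (simp add: test_functions_def)
qed

lemma test_functions_smooth: "f \<in> test_functions \<Longrightarrow> smooth f"
  by (simp add: test_functions_def)

lemma bump_test_functions: "bump n a b \<in> test_functions"
proof (rule test_functionsI[OF smooth_bump])
  show "{q. bump n a b q \<noteq> 0} \<subseteq> cbox a b"
    using box_subset_cbox by (auto simp: bump_eq_0_iff)
qed simp

lemma test_functions_support:
  assumes "f \<in> test_functions"
  shows "f x \<noteq> 0 \<Longrightarrow> x \<in> closure {q. f q \<noteq> 0}" "compact (closure {q. f q \<noteq> 0})"
  using assms closure_subset[of "{q. f q \<noteq> 0}"] by (auto simp: test_functions_def)

lemma test_functions_mult:
  "f \<in> test_functions \<Longrightarrow> smooth g \<Longrightarrow> (\<lambda>q. g q * f q) \<in> test_functions"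
  using test_functions_support[of f]
  by (intro test_functionsI[of _ "closure {q. f q \<noteq> 0}"] smooth_mult) (auto simp: test_functions_smooth)

lemma test_functions_add:
  assumes f: "f \<in> test_functions" and g: "g \<in> test_functions"
  shows "(\<lambda>q. f q + g q) \<in> test_functions"
proof (rule test_functionsI)
  show "{q. f q + g q \<noteq> 0} \<subseteq> closure {q. f q \<noteq> 0} \<union> closure {q. g q \<noteq> 0}"
  proof
    fix x assume "x \<in> {q. f q + g q \<noteq> 0}"
    then have "f x \<noteq> 0 \<or> g x \<noteq> 0"
      by auto
    then show "x \<in> closure {q. f q \<noteq> 0} \<union> closure {q. g q \<noteq> 0}"
      using test_functions_support(1)[OF f] test_functions_support(1)[OF g] by blast
  qed
qed (intro smooth_add test_functions_smooth f g, intro compact_Un test_functions_support f g)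

lemma test_functions_zero: "(\<lambda>q. 0) \<in> test_functions"
  by (rule test_functionsI[of _ "{}"]) (auto intro: smooth_const)

lemma test_functions_sum:
  "(\<And>i. i \<in> I \<Longrightarrow> f i \<in> test_functions) \<Longrightarrow> (\<lambda>q. \<Sum>i\<in>I. f i q) \<in> test_functions"
  by (induction I rule: infinite_finite_induct) (auto intro!: test_functions_zero test_functions_add)

text \<open>Off the closed support \<open>f\<close> vanishes on an open set, so its derivative
  vanishes there and the support cannot grow.\<close>

lemma test_functions_dir_deriv:
  assumes "f \<in> test_functions"
  shows "dir_deriv v f \<in> test_functions"
proof (rule test_functionsI)
  show "smooth (dir_deriv v f)"
    using assms by (intro smooth_dir_deriv test_functions_smooth)
  show "compact (closure {q. f q \<noteq> 0})"
    using assms by (rule test_functions_support)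
  show "{q. dir_deriv v f q \<noteq> 0} \<subseteq> closure {q. f q \<noteq> 0}"
  proof (rule ccontr)
    assume "\<not> ?thesis"
    then obtain q where q: "dir_deriv v f q \<noteq> 0" "q \<in> - closure {q. f q \<noteq> 0}"
      by auto
    have "(f has_derivative (\<lambda>v. 0)) (at q)"
    proof (rule has_derivative_transform_within_open)
      show "((\<lambda>_. 0) has_derivative (\<lambda>v. 0)) (at q)" by simp
      show "open (- closure {q. f q \<noteq> 0})" by (simp add: open_Compl)
      show "0 = f x" if "x \<in> - closure {q. f q \<noteq> 0}" for x
        using that closure_subset[of "{q. f q \<noteq> 0}"] by auto
    qed (fact q)
    with q(1) show False
      by (auto dest: dir_deriv_eq)
  qed
qed

lemma test_functions_L2:
  fixes f :: "'a::euclidean_space \<Rightarrow> real"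
  assumes "f \<in> test_functions"
  shows "f \<in> L2 lborel"
proof -
  let ?K = "closure {q. f q \<noteq> 0}"
  have f: "continuous_on S f" for S
    using assms by (intro smooth_continuous_on test_functions_smooth)
  have "integrable lborel (\<lambda>x. indicator ?K x *\<^sub>R (f x)\<^sup>2)"
    using assms by (intro borel_integrable_compact test_functions_support continuous_intros f)
  also have "(\<lambda>x. indicator ?K x *\<^sub>R (f x)\<^sup>2) = (\<lambda>x. (f x)\<^sup>2)"
    using test_functions_support[OF assms] by (auto simp: indicator_def fun_eq_iff)
  finally show ?thesis
    using borel_measurable_continuous_onI[OF f] by (simp add: L2_def)
qed

section \<open>Rotation invariance of the sub-Laplacian\<close>

lemma X_field_test_functions:
  assumes "f \<in> test_functions"
  shows "X_field i f \<in> test_functions"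
proof -
  have "X_field i f = (\<lambda>q. dir_deriv (axis i 1, 0, 0) f q + (2 * fst (snd q) $ i) * dir_deriv (0, 0, 1) f q)"
    by (auto simp: X_field_def fun_eq_iff)
  also have "\<dots> \<in> test_functions"
    using assms by (intro test_functions_add test_functions_mult test_functions_dir_deriv smooth_linear)
      (auto intro!: linearI simp: linear_conv_bounded_linear[symmetric] algebra_simps)
  finally show ?thesis .
qed

lemma Y_field_test_functions:
  assumes "f \<in> test_functions"
  shows "Y_field i f \<in> test_functions"
proof -
  have "Y_field i f = (\<lambda>q. dir_deriv (0, axis i 1, 0) f q + (- 2 * (fst q $ i)) * dir_deriv (0, 0, 1) f q)"
    by (auto simp: Y_field_def fun_eq_iff)
  also have "\<dots> \<in> test_functions"
    using assms by (intro test_functions_add test_functions_mult test_functions_dir_deriv smooth_linear)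
      (auto intro!: linearI simp: linear_conv_bounded_linear[symmetric] algebra_simps)
  finally show ?thesis .
qed

lemma sublaplacian_test_functions: "f \<in> test_functions \<Longrightarrow> sublaplacian f \<in> test_functions"
  unfolding sublaplacian_def
  by (intro test_functions_sum test_functions_add X_field_test_functions Y_field_test_functions)

text \<open>Once a field is the derivative along one vector depending on \<open>q\<close>, a linear
  change of variables acts on that vector alone.\<close>

lemma X_field_eq:
  assumes "f differentiable (at q)"
  shows "X_field i f q = dir_deriv (axis i 1, 0, 2 * fst (snd q) $ i) f q"
proof -
  interpret D: bounded_linear "\<lambda>v. dir_deriv v f q"
    by (rule has_derivative_bounded_linear[OF has_derivative_dir_deriv[OF assms]])
  show ?thesis
    using D.add[of "(axis i 1, 0, 0)" "(2 * fst (snd q) $ i) *\<^sub>R (0, 0, 1)"]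
      D.scaleR[of "2 * fst (snd q) $ i" "(0, 0, 1)"]
    by (cases q) (simp add: X_field_def)
qed

lemma Y_field_eq:
  assumes "f differentiable (at q)"
  shows "Y_field i f q = dir_deriv (0, axis i 1, - 2 * fst q $ i) f q"
proof -
  interpret D: bounded_linear "\<lambda>v. dir_deriv v f q"
    by (rule has_derivative_bounded_linear[OF has_derivative_dir_deriv[OF assms]])
  show ?thesis
    using D.add[of "(0, axis i 1, 0)" "(- 2 * fst q $ i) *\<^sub>R (0, 0, 1)"]
      D.scaleR[of "- 2 * fst q $ i" "(0, 0, 1)"]
    by (cases q) (simp add: Y_field_def)
qed

lemma dir_deriv_combination:
  assumes "f differentiable (at q)" "g differentiable (at q)"
  shows "dir_deriv v (\<lambda>p. a * f p + b * g p) q = a * dir_deriv v f q + b * dir_deriv v g q"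
  using assms by (intro dir_deriv_eq has_derivative_add has_derivative_mult_right has_derivative_dir_deriv)

lemma bounded_linear_heis_rot: "bounded_linear (heis_rot \<theta>)"
  unfolding linear_conv_bounded_linear[symmetric]
  by (rule linearI) (auto simp: heis_rot_def algebra_simps)

text \<open>By the chain rule it is enough to push the frame vectors forward by the linear map
  \<open>?R\<close>. They become combinations of the frame at the image point with constant
  coefficients, which is what allows the rule to be applied a second time.\<close>

lemma field_rot:
  fixes f :: "'n::finite heis \<Rightarrow> real"
  assumes "\<And>q. f differentiable (at q)"
  shows "X_field i (\<lambda>q. f (heis_rot \<theta> q)) =
      (\<lambda>q. cos \<theta> * X_field i f (heis_rot \<theta> q) + (- sin \<theta>) * Y_field i f (heis_rot \<theta> q))"
    and "Y_field i (\<lambda>q. f (heis_rot \<theta> q)) =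
      (\<lambda>q. sin \<theta> * X_field i f (heis_rot \<theta> q) + cos \<theta> * Y_field i f (heis_rot \<theta> q))"
proof -
  let ?R = "heis_rot \<theta> :: 'n heis \<Rightarrow> 'n heis"
  let ?X = "\<lambda>q. (axis i 1, 0, 2 * fst (snd q) $ i) :: 'n heis"
  let ?Y = "\<lambda>q. (0, axis i 1, - 2 * fst q $ i) :: 'n heis"
  have diff: "(\<lambda>q. f (?R q)) differentiable (at q)" for q
    using differentiable_chain_at[OF bounded_linear_imp_differentiable[OF bounded_linear_heis_rot] assms]
    by (simp add: comp_def)
  have chain: "dir_deriv v (\<lambda>q. f (?R q)) q = dir_deriv (?R v) f (?R q)" for v q
    using dir_deriv_compose_affine[OF bounded_linear_heis_rot, where c = 0, of f \<theta> q v] assms by simp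
  have comb: "dir_deriv (a *\<^sub>R u + b *\<^sub>R w) f q = a * dir_deriv u f q + b * dir_deriv w f q" for a b u w q
  proof -
    interpret D: bounded_linear "\<lambda>v. dir_deriv v f q"
      by (rule has_derivative_bounded_linear[OF has_derivative_dir_deriv[OF assms]])
    show ?thesis by (simp add: D.add D.scaleR)
  qed
  have sc: "(sin \<theta>)\<^sup>2 + (cos \<theta>)\<^sup>2 = 1" by simp
  \<comment> \<open>The horizontal components agree by definition of the rotation; the vertical one
    is the identity shown inside.\<close>
  have X: "?R (?X q) = cos \<theta> *\<^sub>R ?X (?R q) + (- sin \<theta>) *\<^sub>R ?Y (?R q)" for q
  proof -
    obtain x y z where q: "q = (x, y, z)" by (cases q)
    have "2 * y $ i = cos \<theta> * (2 * (cos \<theta> * y $ i - sin \<theta> * x $ i)) + sin \<theta> * (2 * (cos \<theta> * x $ i + sin \<theta> * y $ i))"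
      using sc by algebra
    then show ?thesis
      by (simp add: q heis_rot_def algebra_simps)
  qed
  have Y: "?R (?Y q) = sin \<theta> *\<^sub>R ?X (?R q) + cos \<theta> *\<^sub>R ?Y (?R q)" for q
  proof -
    obtain x y z where q: "q = (x, y, z)" by (cases q)
    have "- (2 * x $ i) = sin \<theta> * (2 * (cos \<theta> * y $ i - sin \<theta> * x $ i)) - cos \<theta> * (2 * (cos \<theta> * x $ i + sin \<theta> * y $ i))"
      using sc by algebra
    then show ?thesis
      by (simp add: q heis_rot_def algebra_simps)
  qed
  show "X_field i (\<lambda>q. f (?R q)) = (\<lambda>q. cos \<theta> * X_field i f (?R q) + (- sin \<theta>) * Y_field i f (?R q))"
    by (rule ext) (simp only: X_field_eq[OF diff] X_field_eq[OF assms] Y_field_eq[OF assms] chain X comb)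
  show "Y_field i (\<lambda>q. f (?R q)) = (\<lambda>q. sin \<theta> * X_field i f (?R q) + cos \<theta> * Y_field i f (?R q))"
    by (rule ext) (simp only: Y_field_eq[OF diff] X_field_eq[OF assms] Y_field_eq[OF assms] chain Y comb)
qed

lemma field_combination:
  assumes "\<And>q. f differentiable (at q)" "\<And>q. g differentiable (at q)"
  shows "X_field i (\<lambda>p. a * f p + b * g p) q = a * X_field i f q + b * X_field i g q"
    and "Y_field i (\<lambda>p. a * f p + b * g p) q = a * Y_field i f q + b * Y_field i g q"
proof -
  have "(\<lambda>p. a * f p + b * g p) differentiable (at q)"
    using assms by (intro derivative_intros)
  then show "X_field i (\<lambda>p. a * f p + b * g p) q = a * X_field i f q + b * X_field i g q"
    and "Y_field i (\<lambda>p. a * f p + b * g p) q = a * Y_field i f q + b * Y_field i g q"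
    using assms by (simp_all add: X_field_eq Y_field_eq dir_deriv_combination)
qed

lemma sublaplacian_rot:
  assumes f: "f \<in> test_functions"
  shows "sublaplacian (\<lambda>q. f (heis_rot \<theta> q)) q = sublaplacian f (heis_rot \<theta> q)"
  unfolding sublaplacian_def
proof (rule sum.cong)
  fix i
  have d: "g differentiable (at q)" if "g \<in> test_functions" for g :: "'n::finite heis \<Rightarrow> real" and q
    using that by (intro smooth_differentiable test_functions_smooth)
  have dX: "X_field i f differentiable (at q)" and dY: "Y_field i f differentiable (at q)" for q
    using f by (auto intro!: d X_field_test_functions Y_field_test_functions)
  have dc: "(\<lambda>p. a * X_field i f p + b * Y_field i f p) differentiable (at q)" for a b q
    using dX dY by (intro derivative_intros)
  have sc: "(sin \<theta>)\<^sup>2 + (cos \<theta>)\<^sup>2 = 1" by simp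
  have X: "X_field i (\<lambda>q. a * X_field i f (heis_rot \<theta> q) + b * Y_field i f (heis_rot \<theta> q)) q =
      cos \<theta> * (a * X_field i (X_field i f) (heis_rot \<theta> q) + b * X_field i (Y_field i f) (heis_rot \<theta> q))
      + (- sin \<theta>) * (a * Y_field i (X_field i f) (heis_rot \<theta> q) + b * Y_field i (Y_field i f) (heis_rot \<theta> q))" for a b q
    using field_rot(1)[OF dc, of i a \<theta> b] by (simp add: field_combination[OF dX dY])
  have Y: "Y_field i (\<lambda>q. a * X_field i f (heis_rot \<theta> q) + b * Y_field i f (heis_rot \<theta> q)) q =
      sin \<theta> * (a * X_field i (X_field i f) (heis_rot \<theta> q) + b * X_field i (Y_field i f) (heis_rot \<theta> q))
      + cos \<theta> * (a * Y_field i (X_field i f) (heis_rot \<theta> q) + b * Y_field i (Y_field i f) (heis_rot \<theta> q))" for a b q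
    using field_rot(2)[OF dc, of i a \<theta> b] by (simp add: field_combination[OF dX dY])
  show "X_field i (X_field i (\<lambda>q. f (heis_rot \<theta> q))) q + Y_field i (Y_field i (\<lambda>q. f (heis_rot \<theta> q))) q
      = X_field i (X_field i f) (heis_rot \<theta> q) + Y_field i (Y_field i f) (heis_rot \<theta> q)"
  proof -
    \<comment> \<open>Here \<open>u\<close> and \<open>v\<close> are sine and cosine,
      \<open>a\<close> and \<open>e\<close> the pure and \<open>b\<close> and \<open>c\<close> the
      mixed second derivatives. Each mixed term cancels by itself, so the commutator of the two
      fields does not enter.\<close>
    have "v * (v * a + (- u) * b) + (- u) * (v * c + (- u) * e)
        + (u * (u * a + v * b) + v * (u * c + v * e)) = (u\<^sup>2 + v\<^sup>2) * (a + e)"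
      for u v a b c e :: real
      by (simp add: algebra_simps power2_eq_square)
    then show ?thesis
      unfolding field_rot[OF d[OF f]] X Y by (simp only: sc mult_1)
  qed
qed simp

section \<open>Contraction semigroups and their generators\<close>

lemma L2_measurable: "f \<in> L2 M \<Longrightarrow> f \<in> borel_measurable M"
  by (simp add: L2_def)

lemma L2_integrable: "f \<in> L2 M \<Longrightarrow> integrable M (\<lambda>x. (f x)\<^sup>2)"
  by (simp add: L2_def)

lemma L2_combination:
  assumes "f \<in> L2 M" "g \<in> L2 M"
  shows "(\<lambda>x. a * f x + b * g x) \<in> L2 M"
proof -
  have [measurable]: "f \<in> borel_measurable M" "g \<in> borel_measurable M"
    using assms by (auto simp: L2_def)
  have "integrable M (\<lambda>x. (a * f x + b * g x)\<^sup>2)"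
  proof (rule Bochner_Integration.integrable_bound)
    show "integrable M (\<lambda>x. 2 * a\<^sup>2 * (f x)\<^sup>2 + 2 * b\<^sup>2 * (g x)\<^sup>2)"
      using assms by (auto simp: L2_def)
    have "(a * f x + b * g x)\<^sup>2 \<le> 2 * a\<^sup>2 * (f x)\<^sup>2 + 2 * b\<^sup>2 * (g x)\<^sup>2" for x
      using zero_le_power2[of "a * f x - b * g x"] by (simp add: power2_eq_square algebra_simps)
    then show "AE x in M. norm ((a * f x + b * g x)\<^sup>2) \<le> norm (2 * a\<^sup>2 * (f x)\<^sup>2 + 2 * b\<^sup>2 * (g x)\<^sup>2)"
      by (auto intro: order_trans[OF _ abs_ge_self])
  qed simp
  then show ?thesis
    by (simp add: L2_def)
qed

lemma L2_diff: "f \<in> L2 M \<Longrightarrow> g \<in> L2 M \<Longrightarrow> (\<lambda>x. f x - g x) \<in> L2 M"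
  using L2_combination[of f M g 1 "-1"] by simp

lemma L2_diff_quotient: "f \<in> L2 M \<Longrightarrow> g \<in> L2 M \<Longrightarrow> (\<lambda>x. (f x - g x) / t) \<in> L2 M"
  using L2_combination[of f M g "1 / t" "- (1 / t)"] by (simp add: diff_divide_distrib)

lemma L2_zero: "(\<lambda>_. 0) \<in> L2 M"
  by (simp add: L2_def)

lemma L2_dist_nonneg: "0 \<le> L2_dist M f g"
  by (simp add: L2_dist_def)

lemma L2_dist_commute: "L2_dist M f g = L2_dist M g f"
  by (simp add: L2_dist_def power2_commute)

lemma L2_dist_self: "L2_dist M f f = 0"
  by (simp add: L2_dist_def)

lemma L2_dist_cong_AE:
  assumes "f \<in> L2 M" "f' \<in> L2 M" "g \<in> L2 M" "g' \<in> L2 M"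
    and "AE x in M. f x = f' x" "AE x in M. g x = g' x"
  shows "L2_dist M f g = L2_dist M f' g'"
proof -
  have [measurable]: "f \<in> borel_measurable M" "f' \<in> borel_measurable M"
      "g \<in> borel_measurable M" "g' \<in> borel_measurable M"
    using assms(1-4) by (auto simp: L2_def)
  have "(\<integral>x. (f x - g x)\<^sup>2 \<partial>M) = (\<integral>x. (f' x - g' x)\<^sup>2 \<partial>M)"
    by (rule integral_cong_AE) (use assms(5,6) in auto)
  then show ?thesis by (simp add: L2_dist_def)
qed

lemma L2_dist_eq_0D:
  assumes "f \<in> L2 M" "g \<in> L2 M" "L2_dist M f g = 0"
  shows "AE x in M. f x = g x"
  using assms integral_nonneg_eq_0_iff_AE[OF L2_integrable[OF L2_diff[of f M g]]]
  by (simp add: L2_dist_def)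

lemma L2_dist_scale: "L2_dist M (\<lambda>x. a * f x) (\<lambda>x. a * g x) = \<bar>a\<bar> * L2_dist M f g"
  by (simp add: L2_dist_def right_diff_distrib[symmetric] power_mult_distrib real_sqrt_mult)

text \<open>The pointwise bound (u + v)^2 <= (1 + b/a) u^2 + (1 + a/b) v^2 is integrated. Its
  weights are chosen so that inserting the bounds a^2 and b^2 gives exactly (a + b)^2.\<close>

lemma L2_dist_triangle:
  assumes f: "f \<in> L2 M" and g: "g \<in> L2 M" and h: "h \<in> L2 M"
  shows "L2_dist M f h \<le> L2_dist M f g + L2_dist M g h"
proof (rule field_le_epsilon)
  fix e :: real assume e: "0 < e"
  \<comment> \<open>The term \<open>e / 2\<close> keeps both denominators positive even if one of
    the distances is 0.\<close>
  define a b where "a = L2_dist M f g + e / 2" and "b = L2_dist M g h + e / 2"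
  have ab: "0 < a" "0 < b"
    using e L2_dist_nonneg[of M] by (auto simp: a_def b_def add_nonneg_pos)
  have fg: "(\<integral>x. (f x - g x)\<^sup>2 \<partial>M) \<le> a\<^sup>2" and gh: "(\<integral>x. (g x - h x)\<^sup>2 \<partial>M) \<le> b\<^sup>2"
    using e power_mono[of "L2_dist M f g" a 2] power_mono[of "L2_dist M g h" b 2]
    by (auto simp: L2_dist_def a_def b_def)
  have "(\<integral>x. (f x - h x)\<^sup>2 \<partial>M) \<le> (\<integral>x. (1 + b / a) * (f x - g x)\<^sup>2 + (1 + a / b) * (g x - h x)\<^sup>2 \<partial>M)"
  proof (rule integral_mono)
    fix x
    define u v where "u = f x - g x" and "v = g x - h x"
    have "0 \<le> (b * u - a * v)\<^sup>2 / (a * b)"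
      using ab by simp
    also have "\<dots> = (1 + b / a) * u\<^sup>2 + (1 + a / b) * v\<^sup>2 - (u + v)\<^sup>2"
      using ab by (simp add: power2_eq_square field_simps)
    finally show "(f x - h x)\<^sup>2 \<le> (1 + b / a) * (f x - g x)\<^sup>2 + (1 + a / b) * (g x - h x)\<^sup>2"
      by (simp add: u_def v_def)
  qed (use f g h in \<open>auto intro!: L2_integrable L2_diff\<close>)
  also have "\<dots> = (1 + b / a) * (\<integral>x. (f x - g x)\<^sup>2 \<partial>M) + (1 + a / b) * (\<integral>x. (g x - h x)\<^sup>2 \<partial>M)"
    by (subst Bochner_Integration.integral_add) (use f g h in \<open>auto intro!: L2_integrable L2_diff\<close>)
  also have "\<dots> \<le> (1 + b / a) * a\<^sup>2 + (1 + a / b) * b\<^sup>2"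
    using ab by (intro add_mono mult_left_mono fg gh) auto
  also have "\<dots> = (a + b)\<^sup>2"
    using ab by (simp add: power2_eq_square field_simps)
  finally have "L2_dist M f h \<le> a + b"
    unfolding L2_dist_def using ab by (intro real_le_lsqrt) auto
  then show "L2_dist M f h \<le> L2_dist M f g + L2_dist M g h + e"
    by (simp add: a_def b_def)
qed

section \<open>Orbits of a contraction semigroup\<close>

context
  fixes M :: "'a measure" and T :: "real \<Rightarrow> ('a \<Rightarrow> real) \<Rightarrow> 'a \<Rightarrow> real"
  assumes T: "contraction_semigroup M T"
begin

lemma semigroup_L2: "0 \<le> t \<Longrightarrow> f \<in> L2 M \<Longrightarrow> T t f \<in> L2 M"
  using T by (simp add: contraction_semigroup_def)

lemma semigroup_linear:
  "0 \<le> t \<Longrightarrow> f \<in> L2 M \<Longrightarrow> g \<in> L2 M \<Longrightarrow>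
    AE x in M. T t (\<lambda>y. a * f y + b * g y) x = a * T t f x + b * T t g x"
  using T by (simp add: contraction_semigroup_def)

lemma semigroup_zero: "f \<in> L2 M \<Longrightarrow> AE x in M. T 0 f x = f x"
  using T by (simp add: contraction_semigroup_def)

lemma semigroup_add:
  "0 \<le> s \<Longrightarrow> 0 \<le> t \<Longrightarrow> f \<in> L2 M \<Longrightarrow> AE x in M. T (s + t) f x = T s (T t f) x"
  using T by (simp add: contraction_semigroup_def)

lemma semigroup_continuous: "f \<in> L2 M \<Longrightarrow> ((\<lambda>t. L2_dist M (T t f) f) \<longlongrightarrow> 0) (at_right 0)"
  using T by (simp add: contraction_semigroup_def)

lemma semigroup_norm: "0 \<le> t \<Longrightarrow> f \<in> L2 M \<Longrightarrow> L2_dist M (T t f) (\<lambda>_. 0) \<le> L2_dist M f (\<lambda>_. 0)"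
  using T by (simp add: contraction_semigroup_def)

lemma semigroup_contraction:
  assumes t: "0 \<le> t" and f: "f \<in> L2 M" and g: "g \<in> L2 M"
  shows "L2_dist M (T t f) (T t g) \<le> L2_dist M f g"
proof -
  have "L2_dist M (T t f) (T t g) = L2_dist M (\<lambda>x. T t f x - T t g x) (\<lambda>_. 0)"
    by (simp add: L2_dist_def)
  also have "\<dots> = L2_dist M (T t (\<lambda>x. f x - g x)) (\<lambda>_. 0)"
    using semigroup_linear[OF t f g, of 1 "-1"]
    by (intro L2_dist_cong_AE L2_diff semigroup_L2 L2_zero assms) auto
  also have "\<dots> \<le> L2_dist M (\<lambda>x. f x - g x) (\<lambda>_. 0)"
    by (intro semigroup_norm L2_diff t f g)
  also have "\<dots> = L2_dist M f g"
    by (simp add: L2_dist_def)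
  finally show ?thesis .
qed

lemma semigroup_commute:
  assumes "0 \<le> s" "0 \<le> t" "f \<in> L2 M"
  shows "AE x in M. T s (T t f) x = T t (T s f) x"
  using semigroup_add[OF assms] semigroup_add[OF assms(2,1,3)]
  by eventually_elim (simp add: add.commute)

text \<open>Factoring out the contraction \<open>T s\<close> bounds increments at any time
  \<open>s\<close> by those at time 0: continuity at 0 becomes uniform in \<open>s\<close>.\<close>

lemma semigroup_increment:
  assumes "0 \<le> s" "0 \<le> d" "f \<in> L2 M"
  shows "L2_dist M (T (s + d) f) (T s f) \<le> L2_dist M (T d f) f"
proof -
  have "L2_dist M (T (s + d) f) (T s f) = L2_dist M (T s (T d f)) (T s f)"
    using assms by (intro L2_dist_cong_AE semigroup_add semigroup_L2) auto
  also have "\<dots> \<le> L2_dist M (T d f) f"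
    using assms by (intro semigroup_contraction semigroup_L2)
  finally show ?thesis .
qed

lemma generatorD:
  assumes "(f, g) \<in> generator M T"
  shows "f \<in> L2 M" "g \<in> L2 M"
    and "((\<lambda>t. L2_dist M (\<lambda>x. (T t f x - f x) / t) g) \<longlongrightarrow> 0) (at_right 0)"
  using assms by (auto simp: generator_def)

text \<open>\<open>T s\<close> commutes with the difference quotients and is a contraction, so the
  quotients at \<open>T s f\<close> converge at least as fast as those at \<open>f\<close>.\<close>

lemma generator_semigroup:
  assumes fg: "(f, g) \<in> generator M T" and s: "0 \<le> s"
  shows "(T s f, T s g) \<in> generator M T"
proof -
  note f = generatorD(1)[OF fg] and g = generatorD(2)[OF fg]
  have le: "L2_dist M (\<lambda>x. (T t (T s f) x - T s f x) / t) (T s g) \<le> L2_dist M (\<lambda>x. (T t f x - f x) / t) g"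
    if t: "0 < t" for t
  proof -
    have "AE x in M. T s (\<lambda>x. 1 / t * T t f x + - (1 / t) * f x) x = 1 / t * T s (T t f) x + - (1 / t) * T s f x"
      using s t f by (intro semigroup_linear semigroup_L2) auto
    moreover have "AE x in M. T s (T t f) x = T t (T s f) x"
      using s t f by (intro semigroup_commute) auto
    ultimately have "AE x in M. (T t (T s f) x - T s f x) / t = T s (\<lambda>x. (T t f x - f x) / t) x"
      by eventually_elim (simp add: diff_divide_distrib)
    then have "L2_dist M (\<lambda>x. (T t (T s f) x - T s f x) / t) (T s g) =
        L2_dist M (T s (\<lambda>x. (T t f x - f x) / t)) (T s g)"
      using s t f g by (intro L2_dist_cong_AE L2_diff_quotient semigroup_L2) auto
    also have "\<dots> \<le> L2_dist M (\<lambda>x. (T t f x - f x) / t) g"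
      using s t f g by (intro semigroup_contraction L2_diff_quotient semigroup_L2) auto
    finally show ?thesis .
  qed
  have "((\<lambda>t. L2_dist M (\<lambda>x. (T t (T s f) x - T s f x) / t) (T s g)) \<longlongrightarrow> 0) (at_right 0)"
    by (rule tendsto_sandwich[OF _ _ tendsto_const generatorD(3)[OF fg]])
      (auto simp: eventually_at_filter L2_dist_nonneg le)
  then show ?thesis
    using f g s by (simp add: generator_def semigroup_L2)
qed

end

text \<open>After allowing a slope \<open>e\<close>, take the last time at which the bound holds.
  Continuity puts that time into the set, and \<open>step\<close> moves past it unless it is already
  \<open>t\<close>.\<close>

lemma nonincreasing_if_right_subdifferential:
  fixes \<psi> :: "real \<Rightarrow> real"
  assumes cont: "continuous_on {0..t} \<psi>" and t: "0 \<le> t"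
    and step: "\<And>s e. 0 \<le> s \<Longrightarrow> 0 < e \<Longrightarrow> eventually (\<lambda>d. \<psi> (s + d) \<le> \<psi> s + e * d) (at_right 0)"
  shows "\<psi> t \<le> \<psi> 0"
proof (rule field_le_epsilon)
  fix e' :: real assume e': "0 < e'"
  \<comment> \<open>The denominator \<open>1 + t\<close> gives a total slack of at most
    \<open>e'\<close> and is positive also for \<open>t = 0\<close>.\<close>
  define e where "e = e' / (1 + t)"
  have e: "0 < e" "e * t \<le> e'"
    using e' t by (auto simp: e_def field_simps)
  define A where "A = {s \<in> {0..t}. \<psi> s - e * s \<le> \<psi> 0}"
  have "compact A"
  proof -
    have "closed A"
      unfolding A_def using cont by (intro continuous_on_closed_Collect_le continuous_intros) auto
    moreover have "bounded A"
      by (rule bounded_subset[of "{0..t}"]) (auto simp: A_def)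
    ultimately show ?thesis by (simp add: compact_eq_bounded_closed)
  qed
  moreover have "A \<noteq> {}"
    using t by (auto simp: A_def intro: exI[of _ 0])
  ultimately obtain s where s: "s \<in> A" "\<And>r. r \<in> A \<Longrightarrow> r \<le> s"
    using compact_attains_sup[of A] by blast
  have "s = t"
  proof (rule ccontr)
    assume "s \<noteq> t"
    with s(1) have st: "0 \<le> s" "s < t" "\<psi> s - e * s \<le> \<psi> 0"
      by (auto simp: A_def)
    have "eventually (\<lambda>d. \<psi> (s + d) \<le> \<psi> s + e * d \<and> d < t - s \<and> 0 < d) (at_right 0)"
      using step[OF st(1) e(1)] st
      by (intro eventually_conj eventually_at_right_less order_tendstoD(2)[OF tendsto_ident_at]) auto
    then obtain d where "\<psi> (s + d) \<le> \<psi> s + e * d" "d < t - s" "0 < d"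
      using eventually_happens[of _ "at_right (0::real)"] by fastforce
    with st have "s + d \<in> A"
      by (auto simp: A_def algebra_simps)
    with s(2)[of "s + d"] \<open>0 < d\<close> show False by simp
  qed
  with s(1) e show "\<psi> t \<le> \<psi> 0 + e'"
    by (auto simp: A_def)
qed

text \<open>
  The distance between two orbits of a point of the common domain has nonpositive upper right
  derivative: after a time \<open>s\<close>, the difference of the two semigroups acts only through the common
  generator up to \<open>o(d)\<close>, and what remains is a contraction.
\<close>

lemma generator_unique:
  assumes T: "contraction_semigroup M T" and S: "contraction_semigroup M S"
    and gen: "generator M T = generator M S" and fg: "(f, g) \<in> generator M T" and t: "0 \<le> t"
  shows "AE x in M. T t f x = S t f x"
proof -
  note f = generatorD(1)[OF T fg]
  note T2 = semigroup_L2[OF T] and S2 = semigroup_L2[OF S]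
  define \<psi> where "\<psi> s = L2_dist M (T s f) (S s f)" for s
  \<comment> \<open>A modulus of continuity for the distance of the orbits that is the same at every
    starting time.\<close>
  define \<omega> where "\<omega> d = L2_dist M (T d f) f + L2_dist M (S d f) f" for d
  have incr: "\<bar>\<psi> (s + d) - \<psi> s\<bar> \<le> \<omega> d" if "0 \<le> s" "0 \<le> d" for s d
  proof -
    have "\<psi> (s + d) \<le> L2_dist M (T (s + d) f) (T s f) + (\<psi> s + L2_dist M (S s f) (S (s + d) f))"
      using L2_dist_triangle[of "T (s + d) f" M "T s f" "S (s + d) f"]
        L2_dist_triangle[of "T s f" M "S s f" "S (s + d) f"] that f
      by (auto simp: \<psi>_def T2 S2)
    moreover have "\<psi> s \<le> L2_dist M (T s f) (T (s + d) f) + (\<psi> (s + d) + L2_dist M (S (s + d) f) (S s f))"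
      using L2_dist_triangle[of "T s f" M "T (s + d) f" "S s f"]
        L2_dist_triangle[of "T (s + d) f" M "S (s + d) f" "S s f"] that f
      by (auto simp: \<psi>_def T2 S2)
    moreover have "L2_dist M (T (s + d) f) (T s f) \<le> L2_dist M (T d f) f"
      "L2_dist M (S (s + d) f) (S s f) \<le> L2_dist M (S d f) f"
      using that f semigroup_increment[OF T] semigroup_increment[OF S] by auto
    ultimately show ?thesis
      by (simp add: \<omega>_def abs_le_iff L2_dist_commute)
  qed
  have "(\<omega> \<longlongrightarrow> 0) (at_right 0)"
    unfolding \<omega>_def using tendsto_add[OF semigroup_continuous[OF T f] semigroup_continuous[OF S f]] by simp
  have cont: "continuous_on {0..t} \<psi>"
    unfolding continuous_on_iff
  proof safe
    fix s e :: real assume e: "0 < e"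
    have "eventually (\<lambda>d. \<omega> d < e) (at_right 0)"
      using \<open>(\<omega> \<longlongrightarrow> 0) (at_right 0)\<close> e by (rule order_tendstoD)
    then obtain r where r: "0 < r" "\<And>d. 0 < d \<Longrightarrow> d < r \<Longrightarrow> \<omega> d < e"
      by (auto simp: eventually_at_right_field)
    have "dist (\<psi> s') (\<psi> s) < e" if "s \<in> {0..t}" "s' \<in> {0..t}" "dist s' s < r" for s'
    proof (cases s s' rule: linorder_cases)
      case less
      then show ?thesis
        using incr[of s "s' - s"] r(2)[of "s' - s"] that by (simp add: dist_real_def)
    next
      case greater
      then show ?thesis
        using incr[of s' "s - s'"] r(2)[of "s - s'"] that by (simp add: dist_real_def)
    qed (use e in simp)
    then show "\<exists>d>0. \<forall>x'\<in>{0..t}. dist x' s < d \<longrightarrow> dist (\<psi> x') (\<psi> s) < e" if "s \<in> {0..t}"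
      using r(1) that by blast
  qed
  have step: "eventually (\<lambda>d. \<psi> (s + d) \<le> \<psi> s + e * d) (at_right 0)" if s: "0 \<le> s" and e: "0 < e" for s e
  proof -
    \<comment> \<open>Both semigroups are restarted from the same point \<open>?u\<close>, where
      they have the same derivative \<open>?v\<close>; the gap between \<open>T s f\<close> and
      \<open>?u\<close> is then only moved by the contraction \<open>T d\<close>.\<close>
    let ?u = "S s f" and ?v = "S s g"
    have uS: "(?u, ?v) \<in> generator M S"
      using fg gen s by (intro generator_semigroup[OF S]) auto
    then have uT: "(?u, ?v) \<in> generator M T"
      by (simp add: gen)
    note u = generatorD(1)[OF S uS] and v = generatorD(2)[OF S uS]
    have "((\<lambda>d. L2_dist M (\<lambda>x. (T d ?u x - ?u x) / d) ?v + L2_dist M (\<lambda>x. (S d ?u x - ?u x) / d) ?v) \<longlongrightarrow> 0 + 0) (at_right 0)"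
      by (intro tendsto_add generatorD(3)[OF T uT] generatorD(3)[OF S uS])
    then have "eventually (\<lambda>d. L2_dist M (\<lambda>x. (T d ?u x - ?u x) / d) ?v
        + L2_dist M (\<lambda>x. (S d ?u x - ?u x) / d) ?v < e) (at_right 0)"
      using e by (intro order_tendstoD(2)) auto
    then show ?thesis
      using eventually_at_right_less[of 0]
    proof eventually_elim
      case (elim d)
      have "\<psi> (s + d) = L2_dist M (T (d + s) f) (S (d + s) f)"
        by (simp add: \<psi>_def add.commute)
      also have "\<dots> = L2_dist M (T d (T s f)) (S d ?u)"
        using s elim f semigroup_add[OF T, of d s f] semigroup_add[OF S, of d s f]
        by (intro L2_dist_cong_AE) (auto intro!: T2 S2)
      also have "\<dots> \<le> L2_dist M (T d (T s f)) (T d ?u) + L2_dist M (T d ?u) (S d ?u)"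
        using s elim f by (intro L2_dist_triangle T2 S2) auto
      also have "L2_dist M (T d (T s f)) (T d ?u) \<le> \<psi> s"
        unfolding \<psi>_def using s elim f by (intro semigroup_contraction[OF T] T2 S2) auto
      also have "L2_dist M (T d ?u) (S d ?u) =
          d * L2_dist M (\<lambda>x. (T d ?u x - ?u x) / d) (\<lambda>x. (S d ?u x - ?u x) / d)"
        using elim L2_dist_scale[of M d "\<lambda>x. (T d ?u x - ?u x) / d" "\<lambda>x. (S d ?u x - ?u x) / d"]
        by (simp add: L2_dist_def)
      also have "L2_dist M (\<lambda>x. (T d ?u x - ?u x) / d) (\<lambda>x. (S d ?u x - ?u x) / d)
          \<le> L2_dist M (\<lambda>x. (T d ?u x - ?u x) / d) ?v + L2_dist M ?v (\<lambda>x. (S d ?u x - ?u x) / d)"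
        using u v elim s f generatorD(2)[OF T fg] by (intro L2_dist_triangle L2_diff_quotient T2 S2) auto
      also have "\<dots> \<le> e"
        using elim by (simp add: L2_dist_commute)
      finally show ?case
        using elim by (simp add: mult.commute)
    qed
  qed
  have "\<psi> 0 = L2_dist M f f"
    unfolding \<psi>_def using f by (intro L2_dist_cong_AE semigroup_zero[OF T] semigroup_zero[OF S] T2 S2) auto
  moreover have "\<psi> t \<le> \<psi> 0"
    by (rule nonincreasing_if_right_subdifferential[OF cont t step])
  ultimately have "\<psi> t = 0"
    using L2_dist_nonneg[of M "T t f" "S t f"] by (simp add: L2_dist_self \<psi>_def)
  then show ?thesis
    unfolding \<psi>_def using f t by (intro L2_dist_eq_0D T2 S2) auto
qed

section \<open>Measure-preserving maps and conjugation of semigroups\<close>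

definition measure_automorphism :: "'a measure \<Rightarrow> ('a \<Rightarrow> 'a) \<Rightarrow> bool" where
  "measure_automorphism M \<phi> \<longleftrightarrow> \<phi> \<in> measurable M M \<and> distr M M \<phi> = M"

lemma measure_automorphism_measurable: "measure_automorphism M \<phi> \<Longrightarrow> \<phi> \<in> measurable M M"
  by (simp add: measure_automorphism_def)

lemma measure_automorphism_AE: "measure_automorphism M \<phi> \<Longrightarrow> AE x in M. P x \<Longrightarrow> AE x in M. P (\<phi> x)"
  unfolding measure_automorphism_def by (metis AE_distrD)

lemma measure_automorphism_compose:
  "measure_automorphism M \<phi> \<Longrightarrow> measure_automorphism M \<psi> \<Longrightarrow> measure_automorphism M (\<lambda>x. \<phi> (\<psi> x))"
  using distr_distr[of \<phi> M M \<psi> M] unfolding measure_automorphism_def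
  by (auto simp: comp_def intro: measurable_compose)

lemma measure_automorphism_integral:
  fixes f :: "'a \<Rightarrow> real"
  assumes "measure_automorphism M \<phi>" "f \<in> borel_measurable M"
  shows "(\<integral>x. f (\<phi> x) \<partial>M) = (\<integral>x. f x \<partial>M)"
  using assms integral_distr[of \<phi> M M f] by (simp add: measure_automorphism_def)

lemma measure_automorphism_integrable:
  fixes f :: "'a \<Rightarrow> real"
  assumes "measure_automorphism M \<phi>" "f \<in> borel_measurable M"
  shows "integrable M (\<lambda>x. f (\<phi> x)) \<longleftrightarrow> integrable M f"
  using assms integrable_distr_eq[of \<phi> M M f] by (simp add: measure_automorphism_def)

lemma measure_automorphism_L2:
  assumes "measure_automorphism M \<phi>" "f \<in> L2 M"
  shows "(\<lambda>x. f (\<phi> x)) \<in> L2 M"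
  using assms measure_automorphism_integrable[OF assms(1), of "\<lambda>x. (f x)\<^sup>2"]
  by (auto simp: L2_def intro: measurable_compose[OF measure_automorphism_measurable])

lemma measure_automorphism_L2_dist:
  assumes "measure_automorphism M \<phi>" "f \<in> L2 M" "g \<in> L2 M"
  shows "L2_dist M (\<lambda>x. f (\<phi> x)) (\<lambda>x. g (\<phi> x)) = L2_dist M f g"
  using measure_automorphism_integral[OF assms(1) borel_measurable_power[OF L2_measurable[OF L2_diff[OF assms(2,3)]]], of 2]
  by (simp add: L2_dist_def)

context
  fixes M :: "'a measure" and T :: "real \<Rightarrow> ('a \<Rightarrow> real) \<Rightarrow> 'a \<Rightarrow> real" and \<phi> \<psi> :: "'a \<Rightarrow> 'a"
  assumes T: "contraction_semigroup M T"
    and \<phi>: "measure_automorphism M \<phi>" and \<psi>: "measure_automorphism M \<psi>"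
    and inverse: "\<And>x. \<phi> (\<psi> x) = x" "\<And>x. \<psi> (\<phi> x) = x"
begin

text \<open>Composition with \<open>\<phi>\<close> is an isometry of the square-integrable functions
  whose inverse is composition with \<open>\<psi>\<close>, and null sets pull back to null sets, so
  every axiom is transported.\<close>

lemma contraction_semigroup_conjugate:
  "contraction_semigroup M (\<lambda>t f x. T t (\<lambda>y. f (\<psi> y)) (\<phi> x))"
proof -
  note \<phi>2 = measure_automorphism_L2[OF \<phi>] and \<psi>2 = measure_automorphism_L2[OF \<psi>]
  note T2 = semigroup_L2[OF T]
  note \<phi>AE = measure_automorphism_AE[OF \<phi>]
  have dist: "L2_dist M (\<lambda>x. T t (\<lambda>y. f (\<psi> y)) (\<phi> x)) g = L2_dist M (T t (\<lambda>y. f (\<psi> y))) (\<lambda>y. g (\<psi> y))"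
    if "0 \<le> t" "f \<in> L2 M" "g \<in> L2 M" for t f g
    using measure_automorphism_L2_dist[OF \<phi>, of "T t (\<lambda>y. f (\<psi> y))" "\<lambda>y. g (\<psi> y)"] that
    by (simp add: inverse T2 \<psi>2)
  show ?thesis
    unfolding contraction_semigroup_def
  proof (intro conjI allI ballI impI)
    fix t f assume t: "(0::real) \<le> t" and f: "f \<in> L2 M"
    show "(\<lambda>x. T t (\<lambda>y. f (\<psi> y)) (\<phi> x)) \<in> L2 M"
      by (intro \<phi>2 T2 \<psi>2 t f)
    show "L2_dist M (\<lambda>x. T t (\<lambda>y. f (\<psi> y)) (\<phi> x)) (\<lambda>_. 0) \<le> L2_dist M f (\<lambda>_. 0)"
      using semigroup_norm[OF T t \<psi>2[OF f]] dist[OF t f L2_zero] measure_automorphism_L2_dist[OF \<psi> f L2_zero]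
      by simp
  next
    fix t f g a b assume "(0::real) \<le> t" "f \<in> L2 M" "g \<in> L2 M"
    then show "AE x in M. T t (\<lambda>y. a * f (\<psi> y) + b * g (\<psi> y)) (\<phi> x)
        = a * T t (\<lambda>y. f (\<psi> y)) (\<phi> x) + b * T t (\<lambda>y. g (\<psi> y)) (\<phi> x)"
      by (intro \<phi>AE semigroup_linear[OF T] \<psi>2)
  next
    fix f assume f: "f \<in> L2 M"
    show "AE x in M. T 0 (\<lambda>y. f (\<psi> y)) (\<phi> x) = f x"
      using \<phi>AE[OF semigroup_zero[OF T \<psi>2[OF f]]] by (simp add: inverse)
    have "((\<lambda>t. L2_dist M (T t (\<lambda>y. f (\<psi> y))) (\<lambda>y. f (\<psi> y))) \<longlongrightarrow> 0) (at_right 0)"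
      using f by (intro semigroup_continuous[OF T] \<psi>2)
    then show "((\<lambda>t. L2_dist M (\<lambda>x. T t (\<lambda>y. f (\<psi> y)) (\<phi> x)) f) \<longlongrightarrow> 0) (at_right 0)"
      by (rule Lim_transform_eventually) (auto simp: eventually_at_filter dist f)
  next
    fix s t f assume "(0::real) \<le> s" "(0::real) \<le> t" "f \<in> L2 M"
    then show "AE x in M. T (s + t) (\<lambda>y. f (\<psi> y)) (\<phi> x)
        = T s (\<lambda>y. T t (\<lambda>y. f (\<psi> y)) (\<phi> (\<psi> y))) (\<phi> x)"
      unfolding inverse by (intro \<phi>AE semigroup_add[OF T] \<psi>2)
  qed
qed

lemma generator_conjugate:
  "(f, g) \<in> generator M (\<lambda>t f x. T t (\<lambda>y. f (\<psi> y)) (\<phi> x)) \<longleftrightarrow>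
    (\<lambda>y. f (\<psi> y), \<lambda>y. g (\<psi> y)) \<in> generator M T"
proof -
  note \<phi>2 = measure_automorphism_L2[OF \<phi>] and \<psi>2 = measure_automorphism_L2[OF \<psi>]
  have L2: "(\<lambda>y. k (\<psi> y)) \<in> L2 M \<longleftrightarrow> k \<in> L2 M" for k :: "'a \<Rightarrow> real"
    using \<phi>2[of "\<lambda>y. k (\<psi> y)"] \<psi>2[of k] by (auto simp: inverse)
  have "L2_dist M (\<lambda>x. (T t (\<lambda>y. f (\<psi> y)) (\<phi> x) - f x) / t) g =
      L2_dist M (\<lambda>x. (T t (\<lambda>y. f (\<psi> y)) x - f (\<psi> x)) / t) (\<lambda>y. g (\<psi> y))"
    if "0 < t" "f \<in> L2 M" "g \<in> L2 M" for t
    using measure_automorphism_L2_dist[OF \<phi>, of "\<lambda>x. (T t (\<lambda>y. f (\<psi> y)) x - f (\<psi> x)) / t" "\<lambda>y. g (\<psi> y)"] that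
    by (simp add: inverse semigroup_L2[OF T] \<psi>2 L2_diff_quotient)
  then have "((\<lambda>t. L2_dist M (\<lambda>x. (T t (\<lambda>y. f (\<psi> y)) (\<phi> x) - f x) / t) g) \<longlongrightarrow> 0) (at_right 0) \<longleftrightarrow>
      ((\<lambda>t. L2_dist M (\<lambda>x. (T t (\<lambda>y. f (\<psi> y)) x - f (\<psi> x)) / t) (\<lambda>y. g (\<psi> y))) \<longlongrightarrow> 0) (at_right 0)"
    if "f \<in> L2 M" "g \<in> L2 M"
    using that by (intro tendsto_cong) (auto simp: eventually_at_filter)
  then show ?thesis
    by (auto simp: generator_def L2)
qed

end

section \<open>Automorphisms of Lebesgue measure on the Heisenberg group\<close>

text \<open>Testing with nonnegative functions makes Tonelli available for maps that act on one
  coordinate at a time.\<close>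

lemma measure_automorphism_lborelI:
  fixes S :: "'a::euclidean_space \<Rightarrow> 'a"
  assumes [measurable]: "S \<in> borel_measurable borel"
    and "\<And>f. f \<in> borel_measurable borel \<Longrightarrow> (\<integral>\<^sup>+p. f (S p) \<partial>lborel) = (\<integral>\<^sup>+p. f p \<partial>lborel)"
  shows "measure_automorphism lborel S"
  unfolding measure_automorphism_def
proof (intro conjI measure_eqI)
  fix A assume "A \<in> sets (distr lborel lborel S)"
  then have [measurable]: "A \<in> sets borel" by simp
  have "emeasure (distr lborel lborel S) A = (\<integral>\<^sup>+p. indicator A p \<partial>distr lborel lborel S)"
    by simp
  also have "\<dots> = (\<integral>\<^sup>+p. indicator A (S p) \<partial>lborel)"
    by (intro nn_integral_distr) auto
  also have "\<dots> = emeasure lborel A"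
    by (subst assms(2)) auto
  finally show "emeasure (distr lborel lborel S) A = emeasure lborel A" .
qed auto

lemma nn_integral_automorphism:
  assumes "measure_automorphism lborel S" "f \<in> borel_measurable borel"
  shows "(\<integral>\<^sup>+p. f (S p) \<partial>lborel) = (\<integral>\<^sup>+p. f p \<partial>lborel)"
  using assms nn_integral_distr[of S lborel lborel f] by (simp add: measure_automorphism_def)

lemma measure_automorphism_translation:
  fixes c :: "'a::euclidean_space"
  shows "measure_automorphism lborel (\<lambda>x. x + c)"
proof -
  have "distr lborel lborel (\<lambda>x. x + c) = distr lborel borel ((+) c)"
    by (intro distr_cong) (auto simp: add.commute)
  then show ?thesis
    by (simp add: measure_automorphism_def lborel_distr_plus)
qed

text \<open>Integrate the moved coordinate first: for fixed \<open>x\<close> the inner integral is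
  invariant under \<open>\<phi> x\<close>.\<close>

lemma measure_automorphism_skew:
  fixes \<phi> :: "'a::euclidean_space \<Rightarrow> 'b::euclidean_space \<Rightarrow> 'b"
  assumes \<phi>: "\<And>x. measure_automorphism lborel (\<phi> x)"
    and meas: "(\<lambda>p. \<phi> (fst p) (snd p)) \<in> borel_measurable borel"
  shows "measure_automorphism lborel (\<lambda>p. (fst p, \<phi> (fst p) (snd p)))"
proof (rule measure_automorphism_lborelI)
  show S: "(\<lambda>p. (fst p, \<phi> (fst p) (snd p))) \<in> borel_measurable borel"
    using meas by (intro borel_measurable_Pair) (auto simp: borel_prod[symmetric])
  fix f :: "'a \<times> 'b \<Rightarrow> ennreal" assume f: "f \<in> borel_measurable borel"
  have f': "f \<in> borel_measurable (lborel \<Otimes>\<^sub>M lborel)"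
    using f by (simp add: lborel_prod)
  have "(\<integral>\<^sup>+p. f (fst p, \<phi> (fst p) (snd p)) \<partial>lborel) =
      (\<integral>\<^sup>+x. \<integral>\<^sup>+y. f (x, \<phi> x y) \<partial>lborel \<partial>lborel)"
    using lborel.nn_integral_fst[of "\<lambda>p. f (fst p, \<phi> (fst p) (snd p))" lborel] measurable_compose[OF S f]
    by (simp add: lborel_prod)
  also have "\<dots> = (\<integral>\<^sup>+x. \<integral>\<^sup>+y. f (x, y) \<partial>lborel \<partial>lborel)"
    using f by (intro nn_integral_cong nn_integral_automorphism[OF \<phi>]) (simp add: borel_prod[symmetric])
  also have "\<dots> = (\<integral>\<^sup>+p. f p \<partial>lborel)"
    using lborel.nn_integral_fst[OF f'] by (simp add: lborel_prod)
  finally show "(\<integral>\<^sup>+p. f (fst p, \<phi> (fst p) (snd p)) \<partial>lborel) = (\<integral>\<^sup>+p. f p \<partial>lborel)" .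
qed

text \<open>The mirror case, where the first coordinate moves; the order of integration is reversed,
  and the inner integral is invariant under translation.\<close>

lemma measure_automorphism_shear:
  fixes g :: "'b::euclidean_space \<Rightarrow> 'a::euclidean_space"
  assumes g: "g \<in> borel_measurable borel"
  shows "measure_automorphism lborel (\<lambda>p. (fst p + g (snd p), snd p))"
proof (rule measure_automorphism_lborelI)
  show S: "(\<lambda>p. (fst p + g (snd p), snd p)) \<in> borel_measurable borel"
    using g by (intro borel_measurable_Pair) (auto simp: borel_prod[symmetric])
  fix f :: "'a \<times> 'b \<Rightarrow> ennreal" assume f: "f \<in> borel_measurable borel"
  have f': "f \<in> borel_measurable (lborel \<Otimes>\<^sub>M lborel)"
    using f by (simp add: lborel_prod)
  have "(\<integral>\<^sup>+p. f (fst p + g (snd p), snd p) \<partial>lborel) =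
      (\<integral>\<^sup>+y. \<integral>\<^sup>+x. f (x + g y, y) \<partial>lborel \<partial>lborel)"
    using lborel_pair.nn_integral_snd[of "\<lambda>p. f (fst p + g (snd p), snd p)"] measurable_compose[OF S f]
    by (simp add: lborel_prod)
  also have "\<dots> = (\<integral>\<^sup>+y. \<integral>\<^sup>+x. f (x, y) \<partial>lborel \<partial>lborel)"
    using f by (intro nn_integral_cong nn_integral_automorphism[OF measure_automorphism_translation, where f = "\<lambda>x. f (x, y)" for y])
      (simp add: borel_prod[symmetric])
  also have "\<dots> = (\<integral>\<^sup>+p. f p \<partial>lborel)"
    using lborel_pair.nn_integral_snd[OF f'] by (simp add: lborel_prod)
  finally show "(\<integral>\<^sup>+p. f (fst p + g (snd p), snd p) \<partial>lborel) = (\<integral>\<^sup>+p. f p \<partial>lborel)" .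
qed

text \<open>Left multiplication by \<open>p\<close> is the translation by \<open>p\<close> after a
  vertical shift that depends only on the horizontal coordinates. The vertical coordinate sits in a
  nested pair, hence two nested skew maps.\<close>

lemma measure_automorphism_heis_mult: "measure_automorphism lborel (heis_mult p)"
proof -
  obtain x0 y0 z0 where p: "p = (x0, y0, z0)" by (cases p)
  define \<tau> where "\<tau> x y = 2 * (\<Sum>i\<in>UNIV. x $ i * y0 $ i - x0 $ i * y $ i)" for x y :: "real ^ 'a"
  have cont: "continuous_on UNIV (\<lambda>p. \<tau> (f p) (g p))"
    if "continuous_on UNIV f" "continuous_on UNIV g" for f g :: "'c::euclidean_space \<Rightarrow> real ^ 'a"
    unfolding \<tau>_def by (intro continuous_intros that)
  have 1: "measure_automorphism lborel (\<lambda>w::(real^'a) \<times> real. (fst w, snd w + \<tau> x (fst w)))" for x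
    by (intro measure_automorphism_skew measure_automorphism_translation borel_measurable_continuous_onI
      continuous_intros cont)
  have "measure_automorphism lborel (\<lambda>q::'a heis. (fst q, (fst (snd q), snd (snd q) + \<tau> (fst q) (fst (snd q)))))"
    by (intro measure_automorphism_skew[where \<phi> = "\<lambda>x w. (fst w, snd w + \<tau> x (fst w))"] 1
      borel_measurable_continuous_onI continuous_intros cont)
  from measure_automorphism_compose[OF measure_automorphism_translation[of p] this]
  have "measure_automorphism lborel (\<lambda>q. (fst q, (fst (snd q), snd (snd q) + \<tau> (fst q) (fst (snd q)))) + p)" .
  also have "(\<lambda>q. (fst q, (fst (snd q), snd (snd q) + \<tau> (fst q) (fst (snd q)))) + p) = heis_mult p"
    by (auto simp: fun_eq_iff heis_mult_def p \<tau>_def)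
  finally show ?thesis .
qed

section \<open>Rotations as automorphisms of measure and group\<close>

lemma heis_rot_add: "heis_rot (s + t) q = heis_rot s (heis_rot t q)"
  by (cases q) (simp add: heis_rot_def sin_add cos_add algebra_simps)

lemma heis_rot_0: "heis_rot 0 q = q"
  by (cases q) (simp add: heis_rot_def)

lemma heis_rot_inverse: "heis_rot \<theta> (heis_rot (- \<theta>) q) = q" "heis_rot (- \<theta>) (heis_rot \<theta> q) = q"
  using heis_rot_add[of \<theta> "- \<theta>" q] heis_rot_add[of "- \<theta>" \<theta> q] by (simp_all add: heis_rot_0)

text \<open>
  A plane rotation by an angle other than a half turn is a product of three shears; arbitrary angles
  are reached by halving.
\<close>

lemma measure_automorphism_heis_rot:
  fixes \<theta> :: real
  shows "measure_automorphism (lborel :: 'n::finite heis measure) (heis_rot \<theta>)"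
proof -
  have nz: "measure_automorphism (lborel :: 'n heis measure) (heis_rot s)" if s: "cos (s / 2) \<noteq> 0" for s
  proof -
    define \<tau> where "\<tau> = tan (s / 2)"
    let ?A = "\<lambda>q::'n heis. (fst q + \<tau> *\<^sub>R fst (snd q), snd q)"
    let ?B = "\<lambda>q::'n heis. (fst q, snd q + (- sin s *\<^sub>R fst q, 0))"
    have A: "measure_automorphism lborel ?A"
      by (rule measure_automorphism_shear[where g = "\<lambda>w. \<tau> *\<^sub>R fst w"])
        (intro borel_measurable_continuous_onI continuous_intros)
    have B: "measure_automorphism lborel ?B"
      by (rule measure_automorphism_skew[where \<phi> = "\<lambda>x w. w + (- sin s *\<^sub>R x, 0)"])
        (intro measure_automorphism_translation borel_measurable_continuous_onI continuous_intros)+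
    have s1: "sin s = 2 * sin (s / 2) * cos (s / 2)" and c1: "cos s = 1 - 2 * (sin (s / 2))\<^sup>2"
      and c2: "cos s = 2 * (cos (s / 2))\<^sup>2 - 1"
      using sin_double[of "s / 2"] cos_double_sin[of "s / 2"] cos_double_cos[of "s / 2"] by simp_all
    \<comment> \<open>With shear coefficients tan(s/2), -sin s, tan(s/2), the identities
      \<open>c\<close> and \<open>t\<close> identify the diagonal and the upper right entry of the
      product of the three shears with those of the rotation.\<close>
    have c: "1 - \<tau> * sin s = cos s"
      unfolding c1 s1 \<tau>_def tan_def using s by (simp add: power2_eq_square)
    have t: "\<tau> * (1 + cos s) = sin s"
      unfolding c2 s1 \<tau>_def tan_def using s by (simp add: power2_eq_square)
    have "?A (?B (?A q)) = heis_rot s q" for q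
    proof -
      obtain x y z where q: "q = (x, y, z)" by (cases q)
      have "x + \<tau> *\<^sub>R y + \<tau> *\<^sub>R (y - sin s *\<^sub>R (x + \<tau> *\<^sub>R y))
          = (1 - \<tau> * sin s) *\<^sub>R x + (\<tau> * (1 + (1 - \<tau> * sin s))) *\<^sub>R y"
        by (simp add: vec_eq_iff algebra_simps)
      moreover have "y - sin s *\<^sub>R (x + \<tau> *\<^sub>R y) = - sin s *\<^sub>R x + (1 - \<tau> * sin s) *\<^sub>R y"
        by (simp add: algebra_simps)
      ultimately show ?thesis
        by (simp add: q heis_rot_def c t)
    qed
    then show ?thesis
      using measure_automorphism_compose[OF A measure_automorphism_compose[OF B A]] by simp
  qed
  show ?thesis
  proof (cases "cos (\<theta> / 2) = 0")
    case True
    \<comment> \<open>Half the angle is admissible: if cos(\<theta>/4) were 0, then cos(\<theta>/2)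
      would be -1 and not 0.\<close>
    then have "cos (\<theta> / 2 / 2) \<noteq> 0"
      using cos_double_cos[of "\<theta> / 2 / 2"] by auto
    from measure_automorphism_compose[OF nz[OF this] nz[OF this]] show ?thesis
      by (simp add: heis_rot_add[symmetric])
  qed (rule nz)
qed

text \<open>In the complex coordinates x - iy the rotation multiplies by a unit scalar, and the
  central term of the product is a multiple of the standard symplectic form, which unit scalars
  preserve.\<close>

lemma heis_rot_mult: "heis_rot \<theta> (heis_mult p q) = heis_mult (heis_rot \<theta> p) (heis_rot \<theta> q)"
proof -
  obtain x y z x' y' z' where pq: "p = (x, y, z)" "q = (x', y', z')" by (cases p; cases q)
  have sc: "(sin \<theta>)\<^sup>2 + (cos \<theta>)\<^sup>2 = 1" by simp
  have "(cos \<theta> * x' $ i + sin \<theta> * y' $ i) * (cos \<theta> * y $ i - sin \<theta> * x $ i)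
      - (cos \<theta> * x $ i + sin \<theta> * y $ i) * (cos \<theta> * y' $ i - sin \<theta> * x' $ i) =
      x' $ i * y $ i - x $ i * y' $ i" for i
    using sc by algebra
  then show ?thesis
    by (simp add: pq heis_rot_def heis_mult_def scaleR_add_right)
qed

lemma heis_rot_inv: "heis_rot \<theta> (heis_inv p) = heis_inv (heis_rot \<theta> p)"
  by (cases p) (simp add: heis_rot_def heis_inv_def)

lemma heis_rot_e: "heis_rot \<theta> heis_e = heis_e"
  by (simp add: heis_rot_def heis_e_def)

section \<open>Functions determined by their integrals over rational boxes\<close>

definition rational_vectors :: "'a::euclidean_space set" where
  "rational_vectors = {a. \<forall>i\<in>Basis. a \<bullet> i \<in> \<rat>}"

lemma countable_rational_vectors: "countable (rational_vectors :: 'a::euclidean_space set)"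
proof (rule countable_subset)
  show "countable ((\<lambda>f. \<Sum>i\<in>Basis. f i *\<^sub>R i) ` (PiE (Basis :: 'a set) (\<lambda>_. \<rat>)))"
    by (intro countable_image countable_PiE countable_rat) auto
  show "rational_vectors \<subseteq> (\<lambda>f. \<Sum>i\<in>Basis. f i *\<^sub>R i) ` (PiE (Basis :: 'a set) (\<lambda>_. \<rat>))"
  proof
    fix a :: 'a assume "a \<in> rational_vectors"
    then show "a \<in> (\<lambda>f. \<Sum>i\<in>Basis. f i *\<^sub>R i) ` (PiE (Basis :: 'a set) (\<lambda>_. \<rat>))"
      by (intro image_eqI[of _ _ "\<lambda>i\<in>Basis. a \<bullet> i"])
        (auto simp: rational_vectors_def euclidean_representation)
  qed
qed

text \<open>Countability permits a common null set for all boxes; stability under intersection and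
  generation of the Borel sets let two measures be compared on them.\<close>

definition rational_boxes :: "'a::euclidean_space set set" where
  "rational_boxes = {box a b | a b. a \<in> rational_vectors \<and> b \<in> rational_vectors}"

lemma countable_rational_boxes: "countable (rational_boxes :: 'a::euclidean_space set set)"
proof -
  have "(rational_boxes :: 'a set set) = (\<lambda>(a, b). box a b) ` (rational_vectors \<times> rational_vectors)"
    by (auto simp: rational_boxes_def)
  moreover have "countable \<dots>"
    by (intro countable_image countable_SIGMA countable_rational_vectors)
  ultimately show ?thesis
    by simp
qed

lemma Int_stable_rational_boxes: "Int_stable rational_boxes"
proof (rule Int_stableI)
  fix A B :: "'a set" assume "A \<in> rational_boxes" "B \<in> rational_boxes"
  then obtain a b c d where AB: "A = box a b" "B = box c d"
    and r: "a \<in> rational_vectors" "b \<in> rational_vectors" "c \<in> rational_vectors" "d \<in> rational_vectors"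
    by (auto simp: rational_boxes_def)
  have "(\<Sum>i\<in>Basis. max (a \<bullet> i) (c \<bullet> i) *\<^sub>R i) \<in> rational_vectors"
    "(\<Sum>i\<in>Basis. min (b \<bullet> i) (d \<bullet> i) *\<^sub>R i) \<in> rational_vectors"
    using r by (simp_all add: rational_vectors_def) (simp_all add: max_def min_def)
  then show "A \<inter> B \<in> rational_boxes"
    unfolding AB box_Int_box rational_boxes_def by blast
qed

lemma sets_borel_eq_rational_boxes:
  "sets borel = sigma_sets UNIV (rational_boxes :: 'a::euclidean_space set set)"
proof
  interpret sigma_algebra UNIV "sigma_sets UNIV (rational_boxes :: 'a set set)"
    by (intro sigma_algebra_sigma_sets) auto
  have "S \<in> sigma_sets UNIV rational_boxes" if "open S" for S :: "'a set"
  proof -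
    have "S = \<Union> {B \<in> rational_boxes. B \<subseteq> S}"
    proof
      show "S \<subseteq> \<Union> {B \<in> rational_boxes. B \<subseteq> S}"
      proof
        fix x assume "x \<in> S"
        then obtain e where e: "0 < e" "ball x e \<subseteq> S"
          using \<open>open S\<close> open_contains_ball by blast
        obtain a b where "\<forall>i\<in>Basis. a \<bullet> i \<in> \<rat> \<and> b \<bullet> i \<in> \<rat>" "x \<in> box a b" "box a b \<subseteq> ball x e"
          using rational_boxes[OF e(1)] by blast
        then show "x \<in> \<Union> {B \<in> rational_boxes. B \<subseteq> S}"
          using e by (auto simp: rational_boxes_def rational_vectors_def)
      qed
    qed auto
    moreover have "\<Union> {B \<in> rational_boxes. B \<subseteq> S} \<in> sigma_sets UNIV rational_boxes"
      by (intro countable_Union) (auto intro: countable_subset[OF _ countable_rational_boxes])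
    ultimately show ?thesis by simp
  qed
  then show "sets borel \<subseteq> sigma_sets UNIV (rational_boxes :: 'a set set)"
    by (auto simp: borel_def intro!: sigma_sets_mono)
  show "sigma_sets UNIV rational_boxes \<subseteq> (sets borel :: 'a set set)"
    by (rule sets.sigma_sets_subset[of _ borel, simplified]) (auto simp: rational_boxes_def)
qed

text \<open>The positive and negative parts of \<open>k\<close> are compared as densities of two
  measures. These agree on a generating system that is stable under intersection, so the densities
  agree almost everywhere, which forces both parts to vanish. Local integrability of
  \<open>k\<close> suffices for this.\<close>

lemma AE_eq_0_if_rational_box_integrals:
  fixes k :: "'a::euclidean_space \<Rightarrow> real"
  assumes [measurable]: "k \<in> borel_measurable borel"
    and int: "\<And>B. B \<in> rational_boxes \<Longrightarrow> integrable lborel (\<lambda>x. k x * indicator B x)"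
    and zero: "\<And>B. B \<in> rational_boxes \<Longrightarrow> (\<integral>x. k x * indicator B x \<partial>lborel) = 0"
  shows "AE x in lborel. k x = 0"
proof -
  define D where "D s = density lborel (\<lambda>x. ennreal (max 0 (s * k x)))" for s :: real
  have pos: "emeasure (D s) B = ennreal (\<integral>x. max 0 (s * k x) * indicator B x \<partial>lborel)"
    "integrable lborel (\<lambda>x. max 0 (s * k x) * indicator B x)" if B: "B \<in> rational_boxes" for B s
  proof -
    have [measurable]: "B \<in> sets borel"
      using B by (auto simp: rational_boxes_def)
    have "integrable lborel (\<lambda>x. max 0 (s * (k x * indicator B x)))"
      by (intro integrable_max integrable_zero integrable_mult_right int B)
    also have "(\<lambda>x. max 0 (s * (k x * indicator B x))) = (\<lambda>x. max 0 (s * k x) * indicator B x)"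
      by (auto simp: indicator_def)
    finally show I: "integrable lborel (\<lambda>x. max 0 (s * k x) * indicator B x)" .
    have "emeasure (D s) B = (\<integral>\<^sup>+x. ennreal (max 0 (s * k x) * indicator B x) \<partial>lborel)"
      unfolding D_def by (subst emeasure_density) (auto intro!: nn_integral_cong simp: indicator_def)
    also have "\<dots> = ennreal (\<integral>x. max 0 (s * k x) * indicator B x \<partial>lborel)"
      by (intro nn_integral_eq_integral I) auto
    finally show "emeasure (D s) B = ennreal (\<integral>x. max 0 (s * k x) * indicator B x \<partial>lborel)" .
  qed
  have "D 1 = D (- 1)"
  proof (rule measure_eqI_generator_eq[OF Int_stable_rational_boxes])
    show "rational_boxes \<subseteq> Pow UNIV" by simp
    show "sets (D 1) = sigma_sets UNIV rational_boxes" "sets (D (- 1)) = sigma_sets UNIV rational_boxes"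
      by (simp_all add: D_def sets_borel_eq_rational_boxes)
    show "emeasure (D 1) B = emeasure (D (- 1)) B" if B: "B \<in> rational_boxes" for B
    proof -
      have "(\<integral>x. max 0 (1 * k x) * indicator B x \<partial>lborel) - (\<integral>x. max 0 (- 1 * k x) * indicator B x \<partial>lborel)
          = (\<integral>x. max 0 (1 * k x) * indicator B x - max 0 (- 1 * k x) * indicator B x \<partial>lborel)"
        by (intro Bochner_Integration.integral_diff[symmetric] pos B)
      also have "\<dots> = (\<integral>x. k x * indicator B x \<partial>lborel)"
        by (intro Bochner_Integration.integral_cong) (auto simp: indicator_def)
      finally show ?thesis
        unfolding pos(1)[OF B] by (simp add: zero[OF B])
    qed
    \<comment> \<open>Exhausting boxes with rational corners; they have finite mass because
      \<open>k\<close> is integrable on each of them.\<close>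
    let ?B = "\<lambda>n. box (- real n *\<^sub>R One) (real n *\<^sub>R One) :: 'a set"
    show "range ?B \<subseteq> rational_boxes"
      by (auto simp: rational_boxes_def rational_vectors_def intro!: exI)
    show "(\<Union>n. ?B n) = UNIV"
      using UN_box_eq_UNIV by simp
    show "emeasure (D 1) (?B n) \<noteq> \<infinity>" for n
    proof -
      have "?B n \<in> rational_boxes"
        using \<open>range ?B \<subseteq> rational_boxes\<close> by blast
      from pos(1)[OF this] show ?thesis by simp
    qed
  qed
  then have "AE x in lborel. ennreal (max 0 (1 * k x)) = ennreal (max 0 (- 1 * k x))"
    unfolding D_def by (subst (asm) sigma_finite_measure.density_unique_iff[OF sigma_finite_lborel]) auto
  then show ?thesis
    by eventually_elim (auto simp: max_def split: if_splits)
qed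

section \<open>Rotation invariance of the heat kernel\<close>

lemma test_functions_rot:
  assumes f: "f \<in> test_functions"
  shows "(\<lambda>q. f (heis_rot \<theta> q)) \<in> test_functions"
proof (rule test_functionsI)
  show "smooth (\<lambda>q. f (heis_rot \<theta> q))"
    using smooth_compose_affine[OF bounded_linear_heis_rot test_functions_smooth[OF f], where c = 0] by simp
  show "compact (heis_rot (- \<theta>) ` closure {q. f q \<noteq> 0})"
    by (intro compact_continuous_image test_functions_support f
      bounded_linear.continuous_on[OF bounded_linear_heis_rot] continuous_on_id)
  show "{q. f (heis_rot \<theta> q) \<noteq> 0} \<subseteq> heis_rot (- \<theta>) ` closure {q. f q \<noteq> 0}"
  proof
    fix q assume "q \<in> {q. f (heis_rot \<theta> q) \<noteq> 0}"
    then have "heis_rot \<theta> q \<in> closure {q. f q \<noteq> 0}"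
      by (intro test_functions_support f) auto
    then show "q \<in> heis_rot (- \<theta>) ` closure {q. f q \<noteq> 0}"
      by (intro image_eqI[of _ _ "heis_rot \<theta> q"]) (simp_all add: heis_rot_inverse)
  qed
qed

text \<open>Rotating the approximating test functions changes none of the distances, and it commutes
  with the sub-Laplacian, so the closure inherits the invariance.\<close>

lemma sublaplacian_L2_rot:
  assumes "(f, g) \<in> sublaplacian_L2"
  shows "(\<lambda>q. f (heis_rot \<theta> q), \<lambda>q. g (heis_rot \<theta> q)) \<in> sublaplacian_L2"
proof -
  note R = measure_automorphism_heis_rot[of \<theta>]
  obtain \<phi> where f: "f \<in> L2 lborel" and g: "g \<in> L2 lborel" and \<phi>: "\<And>k. \<phi> k \<in> test_functions"
    and lim: "(\<lambda>k. L2_dist lborel (\<phi> k) f) \<longlonglongrightarrow> 0" "(\<lambda>k. L2_dist lborel (sublaplacian (\<phi> k)) g) \<longlonglongrightarrow> 0"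
    using assms unfolding sublaplacian_L2_def by blast
  have \<phi>': "(\<lambda>q. \<phi> k (heis_rot \<theta> q)) \<in> test_functions" for k
    by (intro test_functions_rot \<phi>)
  have "L2_dist lborel (\<lambda>q. \<phi> k (heis_rot \<theta> q)) (\<lambda>q. f (heis_rot \<theta> q)) = L2_dist lborel (\<phi> k) f"
    and "L2_dist lborel (sublaplacian (\<lambda>q. \<phi> k (heis_rot \<theta> q))) (\<lambda>q. g (heis_rot \<theta> q))
      = L2_dist lborel (sublaplacian (\<phi> k)) g" for k
    unfolding sublaplacian_rot[OF \<phi>, abs_def]
    by (intro measure_automorphism_L2_dist[OF R] f g test_functions_L2 sublaplacian_test_functions \<phi>)+
  then show ?thesis
    unfolding sublaplacian_L2_def using lim \<phi>'
    by (auto intro!: measure_automorphism_L2[OF R] f g exI[of _ "\<lambda>k q. \<phi> k (heis_rot \<theta> q)"])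
qed

lemma test_functions_sublaplacian_L2:
  assumes "f \<in> test_functions"
  shows "(f, sublaplacian f) \<in> sublaplacian_L2"
  using assms unfolding sublaplacian_L2_def
  by (auto intro!: test_functions_L2 sublaplacian_test_functions exI[of _ "\<lambda>_. f"] simp: L2_dist_self)

lemma heat_kernel_measurable:
  assumes "heat_kernel h" "0 < t"
  shows "h t \<in> borel_measurable borel"
proof -
  have "(\<lambda>q. (t, q)) \<in> measurable borel (restrict_space lborel {0<..} \<Otimes>\<^sub>M lborel)"
    using assms(2) by (intro measurable_Pair) (auto simp: measurable_restrict_space2_iff)
  from measurable_compose[OF this, of "\<lambda>(t, q). h t q" borel] assms(1) show ?thesis
    by (simp add: heat_kernel_def)
qed

text \<open>A test function lies in the domain of the common generator, so \<open>T t\<close> and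
  its conjugate agree on it. Writing both sides through the kernel and substituting a rotated
  variable moves the rotation from the function onto the group product.\<close>

lemma heat_kernel_test_function:
  fixes h :: "real \<Rightarrow> 'n::finite heis \<Rightarrow> real"
  assumes h: "heat_kernel h" and t: "0 < t" and f: "f \<in> test_functions"
  shows "AE q in lborel. (\<integral>q'. h t (heis_rot \<theta> (heis_mult (heis_inv q) q')) * f q' \<partial>lborel)
    = (\<integral>q'. h t (heis_mult (heis_inv q) q') * f q' \<partial>lborel)"
proof -
  let ?R = "heis_rot \<theta> :: 'n heis \<Rightarrow> _" and ?R' = "heis_rot (- \<theta>) :: 'n heis \<Rightarrow> _"
  note R = measure_automorphism_heis_rot
  obtain T where T: "contraction_semigroup lborel T" and gen: "generator lborel T = sublaplacian_L2"
    and kernel: "\<And>f. f \<in> L2 lborel \<Longrightarrow> AE q in lborel.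
       integrable lborel (\<lambda>q'. h t (heis_mult (heis_inv q) q') * f q') \<and>
       T t f q = (\<integral>q'. h t (heis_mult (heis_inv q) q') * f q' \<partial>lborel)"
    using h t unfolding heat_kernel_def by blast
  let ?S = "\<lambda>t f x. T t (\<lambda>y. f (?R' y)) (?R x)"
  have S: "contraction_semigroup lborel ?S"
    by (rule contraction_semigroup_conjugate[OF T R R heis_rot_inverse])
  have "(f, g) \<in> generator lborel ?S \<longleftrightarrow> (f, g) \<in> generator lborel T" for f g
    unfolding generator_conjugate[OF T R R heis_rot_inverse] gen
    using sublaplacian_L2_rot[of f g "- \<theta>"] sublaplacian_L2_rot[of "\<lambda>y. f (?R' y)" "\<lambda>y. g (?R' y)" \<theta>]
    by (auto simp: heis_rot_inverse)
  then have "generator lborel T = generator lborel ?S"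
    by auto
  moreover have "(f, sublaplacian f) \<in> generator lborel T"
    unfolding gen by (rule test_functions_sublaplacian_L2[OF f])
  ultimately have "AE q in lborel. T t f q = ?S t f q"
    using t by (intro generator_unique[OF T S]) auto
  moreover have "AE q in lborel. integrable lborel (\<lambda>q'. h t (heis_mult (heis_inv (?R q)) q') * f (?R' q')) \<and>
       T t (\<lambda>y. f (?R' y)) (?R q) = (\<integral>q'. h t (heis_mult (heis_inv (?R q)) q') * f (?R' q') \<partial>lborel)"
    by (rule measure_automorphism_AE[OF R kernel[OF measure_automorphism_L2[OF R test_functions_L2[OF f]]]])
  moreover note kernel[OF test_functions_L2[OF f]]
  ultimately show ?thesis
  proof eventually_elim
    case (elim q)
    have "(\<integral>q'. h t (heis_mult (heis_inv (?R q)) (?R q')) * f (?R' (?R q')) \<partial>lborel)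
        = (\<integral>q'. h t (heis_mult (heis_inv (?R q)) q') * f (?R' q') \<partial>lborel)"
      using elim by (intro measure_automorphism_integral[OF R]) auto
    with elim show ?case
      by (simp add: heis_rot_inverse heis_rot_inv[symmetric] heis_rot_mult[symmetric])
  qed
qed

lemma box_L2: "indicator (box a b) \<in> L2 lborel"
  by (auto simp: L2_def power2_eq_square indicator_inter_arith[symmetric]
    intro!: integrable_real_indicator emeasure_lborel_box_finite)

text \<open>Since the box indicator dominates every bump on the box, integrability against it covers
  all of them with a single null set.\<close>

lemma heat_kernel_box_integrable:
  assumes h: "heat_kernel h" and t: "0 < t"
  shows "AE q in lborel. integrable lborel (\<lambda>q'. h t (heis_mult (heis_inv q) q') * indicator (box a b) q')"
proof -
  obtain T where "\<And>f. f \<in> L2 lborel \<Longrightarrow> AE q in lborel.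
       integrable lborel (\<lambda>q'. h t (heis_mult (heis_inv q) q') * f q') \<and>
       T t f q = (\<integral>q'. h t (heis_mult (heis_inv q) q') * f q' \<partial>lborel)"
    using h t unfolding heat_kernel_def by blast
  from this[OF box_L2[of a b]] show ?thesis
    by eventually_elim simp
qed

text \<open>The kernel clause is applied to the indicator composed with the inverse rotation,
  evaluated at the rotated point, and the integration variable is then rotated.\<close>

lemma heat_kernel_box_integrable_rot:
  fixes h :: "real \<Rightarrow> 'n::finite heis \<Rightarrow> real"
  assumes h: "heat_kernel h" and t: "0 < t"
  shows "AE q in lborel. integrable lborel (\<lambda>q'. h t (heis_rot \<theta> (heis_mult (heis_inv q) q')) * indicator (box a b) q')"
proof -
  let ?R = "heis_rot \<theta> :: 'n heis \<Rightarrow> _" and ?R' = "heis_rot (- \<theta>) :: 'n heis \<Rightarrow> _"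
  note R = measure_automorphism_heis_rot
  obtain T where kernel: "\<And>f. f \<in> L2 lborel \<Longrightarrow> AE q in lborel.
       integrable lborel (\<lambda>q'. h t (heis_mult (heis_inv q) q') * f q') \<and>
       T t f q = (\<integral>q'. h t (heis_mult (heis_inv q) q') * f q' \<partial>lborel)"
    using h t unfolding heat_kernel_def by blast
  from measure_automorphism_AE[OF R[of \<theta>] kernel[OF measure_automorphism_L2[OF R[of "- \<theta>"] box_L2[of a b]]]]
  show ?thesis
  proof eventually_elim
    case (elim q)
    then have "integrable lborel (\<lambda>q'. h t (heis_mult (heis_inv (?R q)) (?R q')) * indicator (box a b) (?R' (?R q')))"
      by (subst measure_automorphism_integrable[OF R]) auto
    then show ?case
      by (simp add: heis_rot_inverse heis_rot_inv[symmetric] heis_rot_mult[symmetric])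
  qed
qed

lemma heat_kernel_rot:
  fixes h :: "real \<Rightarrow> 'n::finite heis \<Rightarrow> real"
  assumes h: "heat_kernel h" and t: "0 < t"
  shows "AE p in lborel. h t (heis_rot \<theta> p) = h t p"
proof -
  have [measurable]: "h t \<in> borel_measurable borel"
    by (rule heat_kernel_measurable[OF h t])
  have [measurable]: "heis_rot \<theta> \<in> measurable borel (borel :: 'n heis measure)"
    using measure_automorphism_measurable[OF measure_automorphism_heis_rot] by simp
  have L [measurable]: "heis_mult q \<in> measurable borel (borel :: 'n heis measure)" for q
    using measure_automorphism_measurable[OF measure_automorphism_heis_mult] by simp
  \<comment> \<open>All that is needed at \<open>q\<close> for one box: integrability for the
    passage to the limit, and the tested identity for every bump.\<close>
  define good where "good q a b \<longleftrightarrow>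
      integrable lborel (\<lambda>q'. h t (heis_mult (heis_inv q) q') * indicator (box a b) q') \<and>
      integrable lborel (\<lambda>q'. h t (heis_rot \<theta> (heis_mult (heis_inv q) q')) * indicator (box a b) q') \<and>
      (\<forall>n. (\<integral>q'. h t (heis_rot \<theta> (heis_mult (heis_inv q) q')) * bump n a b q' \<partial>lborel)
        = (\<integral>q'. h t (heis_mult (heis_inv q) q') * bump n a b q' \<partial>lborel))" for q a b
  have "AE q in lborel. good q a b" for a b
    unfolding good_def AE_conj_iff AE_all_countable
    by (intro conjI allI heat_kernel_box_integrable heat_kernel_box_integrable_rot heat_kernel_test_function
      bump_test_functions h t)
  then have ae: "AE q in lborel. \<forall>a\<in>rational_vectors. \<forall>b\<in>rational_vectors. good q a b"
    by (intro AE_ball_countable' countable_rational_vectors)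
  \<comment> \<open>Lebesgue measure is not the zero measure, so a property that holds almost
    everywhere holds at some point; this \<open>q\<close> stays fixed from here on.\<close>
  have "ae_filter (lborel :: 'n heis measure) \<noteq> bot"
    by (simp add: ae_filter_eq_bot_iff)
  from eventually_happens'[OF this ae]
  obtain q where "\<forall>a\<in>rational_vectors. \<forall>b\<in>rational_vectors. good q a b" ..
  then have q: "good q a b" if "a \<in> rational_vectors" "b \<in> rational_vectors" for a b
    using that by blast
  define k where "k q' = h t (heis_rot \<theta> (heis_mult (heis_inv q) q')) - h t (heis_mult (heis_inv q) q')" for q'
  have k [measurable]: "k \<in> borel_measurable borel"
    unfolding k_def by measurable
  have int: "integrable lborel (\<lambda>x. k x * indicator (box a b) x)"
    and zero: "(\<integral>x. k x * indicator (box a b) x \<partial>lborel) = 0"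
    if ab: "a \<in> rational_vectors" "b \<in> rational_vectors" for a b
  proof -
    note g = q[OF ab, unfolded good_def]
    note g1 = conjunct1[OF g] and g2 = conjunct1[OF conjunct2[OF g]]
      and g3 = conjunct2[OF conjunct2[OF g], rule_format]
    show int: "integrable lborel (\<lambda>x. k x * indicator (box a b) x)"
      unfolding k_def left_diff_distrib by (rule Bochner_Integration.integrable_diff[OF g2 g1])
    have [measurable]: "bump n a b \<in> borel_measurable borel" for n
      by (rule borel_measurable_continuous_onI[OF smooth_continuous_on[OF smooth_bump]])
    have bound: "\<bar>u * bump n a b x\<bar> \<le> \<bar>u * indicator (box a b) x\<bar>" for u n x
      unfolding abs_mult using bump_bounds[of n a b x] by (intro mult_left_mono) simp_all
    have "(\<lambda>n. \<integral>x. k x * bump n a b x \<partial>lborel) \<longlonglongrightarrow> (\<integral>x. k x * indicator (box a b) x \<partial>lborel)"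
      by (rule integral_dominated_convergence[where w = "\<lambda>x. \<bar>k x * indicator (box a b) x\<bar>"])
        (use int bound in \<open>auto intro!: tendsto_mult bump_tendsto\<close>)
    moreover have "(\<integral>x. k x * bump n a b x \<partial>lborel) = 0" for n
    proof -
      have "integrable lborel (\<lambda>x. h t (heis_mult (heis_inv q) x) * bump n a b x)"
        by (rule Bochner_Integration.integrable_bound[OF g1]) (auto simp: bound)
      moreover have "integrable lborel (\<lambda>x. h t (heis_rot \<theta> (heis_mult (heis_inv q) x)) * bump n a b x)"
        by (rule Bochner_Integration.integrable_bound[OF g2]) (auto simp: bound)
      ultimately show ?thesis
        unfolding k_def left_diff_distrib
        by (subst Bochner_Integration.integral_diff) (simp_all only: g3 diff_self)
    qed
    ultimately show "(\<integral>x. k x * indicator (box a b) x \<partial>lborel) = 0"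
      by (simp add: LIMSEQ_const_iff)
  qed
  have "AE x in lborel. k x = 0"
    using int zero by (intro AE_eq_0_if_rational_box_integrals k) (auto simp: rational_boxes_def)
  \<comment> \<open>The substitution \<open>q' = q \<star> p\<close> preserves null sets and cancels
    the inverse of \<open>q\<close> in the kernel.\<close>
  from measure_automorphism_AE[OF measure_automorphism_heis_mult[of q] this] show ?thesis
    by (simp add: k_def heis_mult_assoc[symmetric] heis_inv_left heis_e_left)
qed

section \<open>The Riesz kernel\<close>

abbreviation positive_times :: "real measure" where
  "positive_times \<equiv> restrict_space lborel {0<..}"

lemma sigma_finite_positive_times: "sigma_finite_measure positive_times"
  by (rule sigma_finite_measure_restrict_space[OF sigma_finite_lborel]) simp

text \<open>\<open>heat_kernel\<close> provides joint measurability only over positive times; as an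
  integral over \<open>positive_times\<close>, the Riesz kernel becomes accessible to
  Fubini.\<close>

lemma G_kernel_eq:
  "G_kernel h \<alpha> q1 q2 = 1 / Gamma \<alpha> *
    (\<integral>t. t powr (\<alpha> - 1) * h t (heis_mult (heis_inv q1) q2) \<partial>positive_times)"
  by (simp add: G_kernel_def set_lebesgue_integral_def integral_restrict_space)

lemma G_kernel_measurable:
  fixes h :: "real \<Rightarrow> 'n::finite heis \<Rightarrow> real"
  assumes "heat_kernel h"
  shows "G_kernel h \<alpha> q1 \<in> borel_measurable lborel"
proof -
  interpret sigma_finite_measure positive_times
    by (rule sigma_finite_positive_times)
  have [measurable]: "(\<lambda>(t, q). h t q) \<in> borel_measurable (positive_times \<Otimes>\<^sub>M lborel)"
    using assms by (simp add: heat_kernel_def)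
  have [measurable]: "heis_mult (heis_inv q1) \<in> measurable lborel (lborel :: 'n heis measure)"
    by (rule measure_automorphism_measurable[OF measure_automorphism_heis_mult])
  have [measurable]: "(\<lambda>t. t powr (\<alpha> - 1)) \<in> borel_measurable positive_times"
    by (intro measurable_restrict_space1) simp
  have "(\<lambda>p. (\<lambda>(t, q). h t q) (snd p, heis_mult (heis_inv q1) (fst p))) \<in> borel_measurable (lborel \<Otimes>\<^sub>M positive_times)"
    by measurable
  then have [measurable]: "(\<lambda>p. h (snd p) (heis_mult (heis_inv q1) (fst p))) \<in> borel_measurable (lborel \<Otimes>\<^sub>M positive_times)"
    by simp
  have "(\<lambda>q. \<integral>t. t powr (\<alpha> - 1) * h t (heis_mult (heis_inv q1) q) \<partial>positive_times) \<in> borel_measurable lborel"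
    by (intro borel_measurable_lebesgue_integral) (simp add: case_prod_beta')
  then show ?thesis
    unfolding G_kernel_eq[abs_def] by measurable
qed

text \<open>Invariance holds for each \<open>t\<close> outside a null set of points. Fubini
  exchanges this into: for almost every point, for almost every \<open>t\<close>. The time
  integrands then agree almost everywhere, so the integrals agree even where both take the
  conventional value 0.\<close>

lemma G_kernel_rot:
  fixes h :: "real \<Rightarrow> 'n::finite heis \<Rightarrow> real"
  assumes h: "heat_kernel h"
  shows "AE q in lborel. G_kernel h \<alpha> (heis_rot \<theta> x) (heis_rot \<theta> q) = G_kernel h \<alpha> x q"
proof -
  interpret P: pair_sigma_finite positive_times "lborel :: 'n heis measure"
    by (intro pair_sigma_finite.intro sigma_finite_positive_times sigma_finite_lborel)
  have hm [measurable]: "(\<lambda>p. h (fst p) (snd p)) \<in> borel_measurable (positive_times \<Otimes>\<^sub>M lborel)"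
    using h by (simp add: heat_kernel_def case_prod_beta')
  have R [measurable]: "heis_rot \<theta> \<in> measurable lborel (lborel :: 'n heis measure)"
    by (rule measure_automorphism_measurable[OF measure_automorphism_heis_rot])
  have hR [measurable]: "(\<lambda>p. h (fst p) (heis_rot \<theta> (snd p))) \<in> borel_measurable (positive_times \<Otimes>\<^sub>M lborel)"
    using measurable_compose[OF measurable_Pair[OF measurable_fst measurable_compose[OF measurable_snd R]] hm] by simp
  have "AE t in positive_times. AE p in lborel. h t (heis_rot \<theta> p) = h t p"
    using heat_kernel_rot[OF h] by (auto simp: AE_restrict_space_iff)
  moreover have "{p \<in> space (positive_times \<Otimes>\<^sub>M lborel). h (fst p) (heis_rot \<theta> (snd p)) = h (fst p) (snd p)}
      \<in> sets (positive_times \<Otimes>\<^sub>M lborel)"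
    by measurable
  ultimately have "AE p in lborel. AE t in positive_times. h t (heis_rot \<theta> p) = h t p"
    using P.AE_commute[of "\<lambda>t p. h t (heis_rot \<theta> p) = h t p"] by simp
  then have "AE q in lborel. AE t in positive_times.
      h t (heis_rot \<theta> (heis_mult (heis_inv x) q)) = h t (heis_mult (heis_inv x) q)"
    by (rule measure_automorphism_AE[OF measure_automorphism_heis_mult])
  then show ?thesis
  proof eventually_elim
    case (elim q)
    have [measurable]: "(\<lambda>t. h t p) \<in> borel_measurable positive_times" for p
      using measurable_compose[OF measurable_Pair2' hm, of p] by simp
    have [measurable]: "(\<lambda>t. t powr (\<alpha> - 1)) \<in> borel_measurable positive_times"
      by (intro measurable_restrict_space1) simp
    have "(\<integral>t. t powr (\<alpha> - 1) * h t (heis_rot \<theta> (heis_mult (heis_inv x) q)) \<partial>positive_times) =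
        (\<integral>t. t powr (\<alpha> - 1) * h t (heis_mult (heis_inv x) q) \<partial>positive_times)"
      by (rule integral_cong_AE) (use elim in auto)
    then show ?case
      by (simp add: G_kernel_eq heis_rot_inv[symmetric] heis_rot_mult[symmetric])
  qed
qed

section \<open>Laws of Gaussian families\<close>

context prob_space
begin

lemma integrable_weighted_iexp:
  fixes w g :: "'a \<Rightarrow> real"
  assumes [measurable]: "w \<in> borel_measurable M" "g \<in> borel_measurable M"
    and "\<And>\<omega>. \<bar>w \<omega>\<bar> \<le> C"
  shows "integrable M (\<lambda>\<omega>. complex_of_real (w \<omega>) * iexp (g \<omega>))"
  by (rule integrable_const_bound[where B = C]) (use assms(3) in \<open>auto simp: norm_mult\<close>)

text \<open>Divided by their common total mass, the weights become probability densities, and Levy's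
  uniqueness theorem applies to the laws of \<open>X\<close> and \<open>Y\<close> under them. If the
  mass is 0, both weights vanish almost everywhere.\<close>

lemma weighted_law_unique:
  fixes X Y w v :: "'a \<Rightarrow> real"
  assumes [measurable]: "X \<in> borel_measurable M" "Y \<in> borel_measurable M"
      "w \<in> borel_measurable M" "v \<in> borel_measurable M"
    and w: "\<And>\<omega>. 0 \<le> w \<omega>" "\<And>\<omega>. w \<omega> \<le> C" and v: "\<And>\<omega>. 0 \<le> v \<omega>" "\<And>\<omega>. v \<omega> \<le> C"
    and char: "\<And>s. (\<integral>\<omega>. complex_of_real (w \<omega>) * iexp (s * X \<omega>) \<partial>M) = (\<integral>\<omega>. complex_of_real (v \<omega>) * iexp (s * Y \<omega>) \<partial>M)"
    and [measurable]: "A \<in> sets borel"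
  shows "(\<integral>\<omega>. w \<omega> * indicator A (X \<omega>) \<partial>M) = (\<integral>\<omega>. v \<omega> * indicator A (Y \<omega>) \<partial>M)"
proof -
  have iw: "integrable M w" and iv: "integrable M v"
    using w v by (auto intro!: integrable_const_bound[where B = C])
  define c where "c = (\<integral>\<omega>. w \<omega> \<partial>M)"
  \<comment> \<open>At frequency 0 the hypothesis says that the total masses coincide.\<close>
  have cv: "c = (\<integral>\<omega>. v \<omega> \<partial>M)"
    using char[of 0] by (simp add: c_def)
  have "0 \<le> c"
    using w by (simp add: c_def)
  show ?thesis
  proof (cases "c = 0")
    case True
    then have wv0: "AE \<omega> in M. w \<omega> = 0" "AE \<omega> in M. v \<omega> = 0"
      using integral_nonneg_eq_0_iff_AE[OF iw] integral_nonneg_eq_0_iff_AE[OF iv] w v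
      by (simp_all add: c_def[symmetric] cv[symmetric])
    have "(\<integral>\<omega>. w \<omega> * indicator A (X \<omega>) \<partial>M) = (\<integral>\<omega>. 0 \<partial>M)"
      by (rule integral_cong_AE) (use wv0(1) in auto)
    moreover have "(\<integral>\<omega>. v \<omega> * indicator A (Y \<omega>) \<partial>M) = (\<integral>\<omega>. 0 \<partial>M)"
      by (rule integral_cong_AE) (use wv0(2) in auto)
    ultimately show ?thesis by simp
  next
    case False
    with \<open>0 \<le> c\<close> have c: "0 < c" by simp
    define D where "D u Z = distr (density M (\<lambda>\<omega>. ennreal (u \<omega> / c))) borel Z" for u Z :: "'a \<Rightarrow> real"
    have D: "real_distribution (D u Z)"
      if [measurable]: "u \<in> borel_measurable M" "Z \<in> borel_measurable M"
        and u: "\<And>\<omega>. 0 \<le> u \<omega>" "integrable M u" "(\<integral>\<omega>. u \<omega> \<partial>M) = c" for u Z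
    proof -
      have "(\<integral>\<^sup>+\<omega>. ennreal (u \<omega> / c) \<partial>M) = ennreal (\<integral>\<omega>. u \<omega> / c \<partial>M)"
        using u c by (intro nn_integral_eq_integral) auto
      then have "prob_space (density M (\<lambda>\<omega>. ennreal (u \<omega> / c)))"
        using u c by (intro prob_spaceI) (simp add: emeasure_density cong: nn_integral_cong)
      then show ?thesis
        unfolding D_def by (intro prob_space.real_distribution_distr) simp_all
    qed
    have D_integral: "(\<integral>x. f x \<partial>D u Z) = (\<integral>\<omega>. (u \<omega> / c) *\<^sub>R f (Z \<omega>) \<partial>M)"
      if [measurable]: "u \<in> borel_measurable M" "Z \<in> borel_measurable M" "f \<in> borel_measurable borel"
        and u: "\<And>\<omega>. 0 \<le> u \<omega>" "integrable M u" "(\<integral>\<omega>. u \<omega> \<partial>M) = c"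
      for u Z and f :: "real \<Rightarrow> 'b::{banach, second_countable_topology}"
      unfolding D_def using u c by (simp add: integral_distr integral_density)
    have "char (D w X) s = char (D v Y) s" for s
    proof -
      have "(\<integral>\<omega>. (w \<omega> / c) *\<^sub>R iexp (s * X \<omega>) \<partial>M) = (\<integral>\<omega>. complex_of_real (w \<omega>) * iexp (s * X \<omega>) \<partial>M) / c"
        "(\<integral>\<omega>. (v \<omega> / c) *\<^sub>R iexp (s * Y \<omega>) \<partial>M) = (\<integral>\<omega>. complex_of_real (v \<omega>) * iexp (s * Y \<omega>) \<partial>M) / c"
        by (simp_all add: scaleR_conv_of_real)
      moreover have "char (D w X) s = (\<integral>\<omega>. (w \<omega> / c) *\<^sub>R iexp (s * X \<omega>) \<partial>M)"
        unfolding char_def by (rule D_integral) (use w iw in \<open>auto simp: c_def\<close>)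
      moreover have "char (D v Y) s = (\<integral>\<omega>. (v \<omega> / c) *\<^sub>R iexp (s * Y \<omega>) \<partial>M)"
        unfolding char_def by (rule D_integral) (use v iv cv in auto)
      ultimately show ?thesis
        by (simp only: char)
    qed
    then have "char (D w X) = char (D v Y)"
      by (rule ext)
    moreover have "real_distribution (D w X)"
      by (rule D) (use w iw in \<open>auto simp: c_def\<close>)
    moreover have "real_distribution (D v Y)"
      by (rule D) (use v iv cv in auto)
    ultimately have "D w X = D v Y"
      by (intro Levy_uniqueness)
    then have "(\<integral>x. indicator A x \<partial>D w X) = (\<integral>x. indicator A x \<partial>D v Y :: real)"
      by simp
    moreover have "(\<integral>x. indicator A x \<partial>D w X) = (\<integral>\<omega>. (w \<omega> / c) *\<^sub>R indicator A (X \<omega>) \<partial>M :: real)"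
      by (rule D_integral) (use w iw in \<open>auto simp: c_def\<close>)
    moreover have "(\<integral>x. indicator A x \<partial>D v Y) = (\<integral>\<omega>. (v \<omega> / c) *\<^sub>R indicator A (Y \<omega>) \<partial>M :: real)"
      by (rule D_integral) (use v iv cv in auto)
    ultimately show ?thesis
      using c by simp
  qed
qed

text \<open>
  Multiplying by the nonnegative weights \<open>1\<close>, \<open>1 + cos U\<close> and \<open>1 + sin U\<close> reduces this complex
  identity to the uniqueness theorem for real characteristic functions.
\<close>

lemma replace_iexp_by_indicator:
  fixes X X' U U' P P' :: "'a \<Rightarrow> real"
  assumes [measurable]: "X \<in> borel_measurable M" "X' \<in> borel_measurable M" "U \<in> borel_measurable M"
      "U' \<in> borel_measurable M" "P \<in> borel_measurable M" "P' \<in> borel_measurable M"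
    and P: "\<And>\<omega>. 0 \<le> P \<omega>" "\<And>\<omega>. P \<omega> \<le> 1" and P': "\<And>\<omega>. 0 \<le> P' \<omega>" "\<And>\<omega>. P' \<omega> \<le> 1"
    and char: "\<And>s b. (\<integral>\<omega>. complex_of_real (P \<omega>) * iexp (s * X \<omega> + b * U \<omega>) \<partial>M)
      = (\<integral>\<omega>. complex_of_real (P' \<omega>) * iexp (s * X' \<omega> + b * U' \<omega>) \<partial>M)"
    and A [measurable]: "A \<in> sets borel"
  shows "(\<integral>\<omega>. complex_of_real (P \<omega> * indicator A (X \<omega>)) * iexp (U \<omega>) \<partial>M)
    = (\<integral>\<omega>. complex_of_real (P' \<omega> * indicator A (X' \<omega>)) * iexp (U' \<omega>) \<partial>M)"
proof -
  define E where "E s b Q Z V = (\<integral>\<omega>. complex_of_real (Q \<omega>) * iexp (s * Z \<omega> + b * V \<omega>) \<partial>M)"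
    for s b :: real and Q Z V :: "'a \<Rightarrow> real"
  have E: "E s b P X U = E s b P' X' U'" for s b
    unfolding E_def by (rule char)
  have expand: "(\<integral>\<omega>. complex_of_real (Q \<omega> * (1 + cos (V \<omega>))) * iexp (s * Z \<omega>) \<partial>M) =
        E s 0 Q Z V + (E s 1 Q Z V + E s (- 1) Q Z V) / 2" (is ?cos)
    "(\<integral>\<omega>. complex_of_real (Q \<omega> * (1 + sin (V \<omega>))) * iexp (s * Z \<omega>) \<partial>M) =
        E s 0 Q Z V + (E s 1 Q Z V - E s (- 1) Q Z V) / (2 * \<i>)" (is ?sin)
    "(\<integral>\<omega>. complex_of_real (Q \<omega> * indicator A (Z \<omega>)) * iexp (V \<omega>) \<partial>M) =
        of_real ((\<integral>\<omega>. Q \<omega> * (1 + cos (V \<omega>)) * indicator A (Z \<omega>) \<partial>M) - (\<integral>\<omega>. Q \<omega> * indicator A (Z \<omega>) \<partial>M))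
        + \<i> * of_real ((\<integral>\<omega>. Q \<omega> * (1 + sin (V \<omega>)) * indicator A (Z \<omega>) \<partial>M) - (\<integral>\<omega>. Q \<omega> * indicator A (Z \<omega>) \<partial>M))" (is ?ind)
    if [measurable]: "Q \<in> borel_measurable M" "Z \<in> borel_measurable M" "V \<in> borel_measurable M"
      and Q: "\<And>\<omega>. 0 \<le> Q \<omega>" "\<And>\<omega>. Q \<omega> \<le> 1" for Q Z V :: "'a \<Rightarrow> real" and s :: real
  proof -
    have int: "integrable M (\<lambda>\<omega>. complex_of_real (Q \<omega>) * iexp (s * Z \<omega> + b * V \<omega>))" for b
      by (rule integrable_weighted_iexp[where C = 1]) (use Q in auto)
    have trig: "complex_of_real (cos x) = (iexp x + iexp (- x)) / 2"
      "complex_of_real (sin x) = (iexp x - iexp (- x)) / (2 * \<i>)" for x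
      by (simp_all add: cos_of_real[symmetric] sin_of_real[symmetric] cos_exp_eq sin_exp_eq)
    have "complex_of_real (Q \<omega> * (1 + cos (V \<omega>))) * iexp (s * Z \<omega>) =
        complex_of_real (Q \<omega>) * iexp (s * Z \<omega> + 0 * V \<omega>) + (complex_of_real (Q \<omega>) * iexp (s * Z \<omega> + 1 * V \<omega>)
        + complex_of_real (Q \<omega>) * iexp (s * Z \<omega> + (- 1) * V \<omega>)) / 2" for \<omega>
      unfolding of_real_mult of_real_add trig by (simp add: exp_add[symmetric] algebra_simps add_divide_distrib)
    then show ?cos
      unfolding E_def using int[of 0] int[of 1] int[of "-1"]
      by (simp only: Bochner_Integration.integral_add Bochner_Integration.integrable_add
        integrable_divide integral_divide_zero)
    have "complex_of_real (Q \<omega> * (1 + sin (V \<omega>))) * iexp (s * Z \<omega>) =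
        complex_of_real (Q \<omega>) * iexp (s * Z \<omega> + 0 * V \<omega>) + (complex_of_real (Q \<omega>) * iexp (s * Z \<omega> + 1 * V \<omega>)
        - complex_of_real (Q \<omega>) * iexp (s * Z \<omega> + (- 1) * V \<omega>)) / (2 * \<i>)" for \<omega>
      unfolding of_real_mult of_real_add trig by (simp add: exp_add[symmetric] algebra_simps diff_divide_distrib)
    then show ?sin
      unfolding E_def using int[of 0] int[of 1] int[of "-1"]
      by (simp only: Bochner_Integration.integral_add Bochner_Integration.integral_diff
        Bochner_Integration.integrable_diff integrable_divide integral_divide_zero)
    have bound: "\<bar>Q \<omega> * y * indicator A (Z \<omega>)\<bar> \<le> 2" if "\<bar>y\<bar> \<le> 2" for \<omega> y
      using Q[of \<omega>] that mult_mono[of "\<bar>Q \<omega>\<bar>" 1 "\<bar>y\<bar>" 2] by (auto simp: abs_mult indicator_def)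
    have i0: "integrable M (\<lambda>\<omega>. Q \<omega> * indicator A (Z \<omega>))"
      by (rule integrable_const_bound[where B = 1]) (use Q in \<open>auto simp: indicator_def\<close>)
    have abs2: "\<bar>1 + cos x\<bar> \<le> 2" "\<bar>1 + sin x\<bar> \<le> 2" for x :: real
      using cos_ge_minus_one[of x] cos_le_one[of x] sin_ge_minus_one[of x] sin_le_one[of x]
      unfolding abs_le_iff by linarith+
    have i1: "integrable M (\<lambda>\<omega>. Q \<omega> * (1 + cos (V \<omega>)) * indicator A (Z \<omega>))"
      and i2: "integrable M (\<lambda>\<omega>. Q \<omega> * (1 + sin (V \<omega>)) * indicator A (Z \<omega>))"
      by (rule integrable_const_bound[where B = 2]; simp add: bound abs2)+
    have "(\<integral>\<omega>. complex_of_real (Q \<omega> * indicator A (Z \<omega>)) * iexp (V \<omega>) \<partial>M) =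
      (\<integral>\<omega>. of_real (Q \<omega> * (1 + cos (V \<omega>)) * indicator A (Z \<omega>) - Q \<omega> * indicator A (Z \<omega>))
        + \<i> * of_real (Q \<omega> * (1 + sin (V \<omega>)) * indicator A (Z \<omega>) - Q \<omega> * indicator A (Z \<omega>)) \<partial>M)"
      by (intro Bochner_Integration.integral_cong refl)
        (simp add: exp_Euler cos_of_real sin_of_real algebra_simps)
    also have "\<dots> = (\<integral>\<omega>. complex_of_real (Q \<omega> * (1 + cos (V \<omega>)) * indicator A (Z \<omega>) - Q \<omega> * indicator A (Z \<omega>)) \<partial>M)
        + \<i> * (\<integral>\<omega>. complex_of_real (Q \<omega> * (1 + sin (V \<omega>)) * indicator A (Z \<omega>) - Q \<omega> * indicator A (Z \<omega>)) \<partial>M)"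
      by (subst Bochner_Integration.integral_add)
        (intro integrable_of_real integrable_mult_right Bochner_Integration.integrable_diff i0 i1 i2
          | simp only: integral_mult_right_zero)+
    finally show ?ind
      unfolding integral_complex_of_real
      by (simp only: Bochner_Integration.integral_diff i0 i1 i2)
  qed
  note e = expand[of P X U] expand[of P' X' U']
  have "(\<integral>\<omega>. P \<omega> * indicator A (X \<omega>) \<partial>M) = (\<integral>\<omega>. P' \<omega> * indicator A (X' \<omega>) \<partial>M)"
    by (rule weighted_law_unique[where C = 1]) (use P P' char[of _ 0] A in simp_all)
  moreover have "(\<integral>\<omega>. P \<omega> * (1 + cos (U \<omega>)) * indicator A (X \<omega>) \<partial>M) = (\<integral>\<omega>. P' \<omega> * (1 + cos (U' \<omega>)) * indicator A (X' \<omega>) \<partial>M)"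
  proof (rule weighted_law_unique[where C = 2])
    have *: "0 \<le> 1 + cos x" "1 + cos x \<le> 2" for x :: real
      using cos_ge_minus_one[of x] cos_le_one[of x] by linarith+
    show "0 \<le> P \<omega> * (1 + cos (U \<omega>))" "0 \<le> P' \<omega> * (1 + cos (U' \<omega>))" for \<omega>
      by (intro mult_nonneg_nonneg P P' *)+
    show "P \<omega> * (1 + cos (U \<omega>)) \<le> 2" "P' \<omega> * (1 + cos (U' \<omega>)) \<le> 2" for \<omega>
      using mult_mono[OF P(2) *(2) _ *(1), of \<omega> "U \<omega>"] mult_mono[OF P'(2) *(2) _ *(1), of \<omega> "U' \<omega>"]
      by simp_all
  qed (simp_all only: e E P P' A assms(1-6), measurable)
  moreover have "(\<integral>\<omega>. P \<omega> * (1 + sin (U \<omega>)) * indicator A (X \<omega>) \<partial>M) = (\<integral>\<omega>. P' \<omega> * (1 + sin (U' \<omega>)) * indicator A (X' \<omega>) \<partial>M)"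
  proof (rule weighted_law_unique[where C = 2])
    have *: "0 \<le> 1 + sin x" "1 + sin x \<le> 2" for x :: real
      using sin_ge_minus_one[of x] sin_le_one[of x] by linarith+
    show "0 \<le> P \<omega> * (1 + sin (U \<omega>))" "0 \<le> P' \<omega> * (1 + sin (U' \<omega>))" for \<omega>
      by (intro mult_nonneg_nonneg P P' *)+
    show "P \<omega> * (1 + sin (U \<omega>)) \<le> 2" "P' \<omega> * (1 + sin (U' \<omega>)) \<le> 2" for \<omega>
      using mult_mono[OF P(2) *(2) _ *(1), of \<omega> "U \<omega>"] mult_mono[OF P'(2) *(2) _ *(1), of \<omega> "U' \<omega>"]
      by simp_all
  qed (simp_all only: e E P P' A assms(1-6), measurable)
  ultimately show ?thesis
    by (simp only: e P P' assms(1-6))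
qed

text \<open>Rectangles determine a finite measure on the product. Their probabilities are reached
  from the joint characteristic function by replacing the exponentials one coordinate at a time by
  indicators.\<close>

lemma law_eq_if_char_eq:
  fixes X Y :: "'i \<Rightarrow> 'a \<Rightarrow> real"
  assumes J: "finite J"
    and X [measurable]: "\<And>j. j \<in> J \<Longrightarrow> X j \<in> borel_measurable M"
    and Y [measurable]: "\<And>j. j \<in> J \<Longrightarrow> Y j \<in> borel_measurable M"
    and char: "\<And>c. (\<integral>\<omega>. iexp (\<Sum>j\<in>J. c j * X j \<omega>) \<partial>M) = (\<integral>\<omega>. iexp (\<Sum>j\<in>J. c j * Y j \<omega>) \<partial>M)"
  shows "distr M (\<Pi>\<^sub>M j\<in>J. borel) (\<lambda>\<omega>. \<lambda>j\<in>J. X j \<omega>) = distr M (\<Pi>\<^sub>M j\<in>J. borel) (\<lambda>\<omega>. \<lambda>j\<in>J. Y j \<omega>)"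
proof (rule measure_eqI_PiM_finite[OF J])
  fix A :: "'i \<Rightarrow> real set" assume A: "\<And>j. j \<in> J \<Longrightarrow> A j \<in> sets borel"
  \<comment> \<open>Coordinates in \<open>S\<close> already carry indicators, the others still
    exponentials. The coefficients \<open>c\<close> must stay arbitrary, since each step uses the
    hypothesis at modified ones.\<close>
  have step: "S \<subseteq> J \<Longrightarrow>
      (\<integral>\<omega>. complex_of_real (\<Prod>j\<in>S. indicator (A j) (X j \<omega>)) * iexp (\<Sum>j\<in>J - S. c j * X j \<omega>) \<partial>M)
      = (\<integral>\<omega>. complex_of_real (\<Prod>j\<in>S. indicator (A j) (Y j \<omega>)) * iexp (\<Sum>j\<in>J - S. c j * Y j \<omega>) \<partial>M)"
    if "finite S" for S c
    using that
  proof (induction S arbitrary: c rule: finite_induct)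
    case empty
    then show ?case using char[of c] by simp
  next
    case (insert k S)
    then have k: "k \<in> J" "k \<in> J - S" and S: "\<And>j. j \<in> S \<Longrightarrow> j \<in> J" by auto
    \<comment> \<open>The frequency \<open>s\<close> of the new coordinate and a common scaling
      \<open>b\<close> of the remaining ones are separated, as
      \<open>replace_iexp_by_indicator\<close> requires.\<close>
    have split: "(\<Sum>j\<in>J - S. (if j = k then s else b * c j) * Z j \<omega>) =
        s * Z k \<omega> + b * (\<Sum>j\<in>J - insert k S. c j * Z j \<omega>)" for s b and Z :: "'i \<Rightarrow> 'a \<Rightarrow> real" and \<omega>
    proof -
      have "(\<Sum>j\<in>J - S - {k}. (if j = k then s else b * c j) * Z j \<omega>) = (\<Sum>j\<in>J - S - {k}. b * (c j * Z j \<omega>))"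
        by (intro sum.cong) auto
      moreover have "J - insert k S = J - S - {k}" by auto
      ultimately show ?thesis
        using J k by (subst sum.remove[of _ k]) (auto simp: sum_distrib_left)
    qed
    have "(\<integral>\<omega>. complex_of_real ((\<Prod>j\<in>S. indicator (A j) (X j \<omega>)) * indicator (A k) (X k \<omega>)) * iexp (\<Sum>j\<in>J - insert k S. c j * X j \<omega>) \<partial>M)
      = (\<integral>\<omega>. complex_of_real ((\<Prod>j\<in>S. indicator (A j) (Y j \<omega>)) * indicator (A k) (Y k \<omega>)) * iexp (\<Sum>j\<in>J - insert k S. c j * Y j \<omega>) \<partial>M)"
    proof (rule replace_iexp_by_indicator)
      have ind: "(\<lambda>\<omega>. indicator (A j) (Z \<omega>) :: real) \<in> borel_measurable M"
        if "j \<in> S" "Z \<in> borel_measurable M" for j Z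
        by (rule measurable_compose[OF that(2) borel_measurable_indicator[OF A[OF S[OF that(1)]]]])
      show "(\<lambda>\<omega>. \<Prod>j\<in>S. indicator (A j) (X j \<omega>) :: real) \<in> borel_measurable M"
        by (rule borel_measurable_prod) (intro ind X S)
      show "(\<lambda>\<omega>. \<Prod>j\<in>S. indicator (A j) (Y j \<omega>) :: real) \<in> borel_measurable M"
        by (rule borel_measurable_prod) (intro ind Y S)
      show "(\<lambda>\<omega>. \<Sum>j\<in>J - insert k S. c j * X j \<omega>) \<in> borel_measurable M"
        by (intro borel_measurable_sum borel_measurable_times borel_measurable_const X) auto
      show "(\<lambda>\<omega>. \<Sum>j\<in>J - insert k S. c j * Y j \<omega>) \<in> borel_measurable M"
        by (intro borel_measurable_sum borel_measurable_times borel_measurable_const Y) auto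
      show "(\<integral>\<omega>. complex_of_real (\<Prod>j\<in>S. indicator (A j) (X j \<omega>)) * iexp (s * X k \<omega> + b * (\<Sum>j\<in>J - insert k S. c j * X j \<omega>)) \<partial>M) =
          (\<integral>\<omega>. complex_of_real (\<Prod>j\<in>S. indicator (A j) (Y j \<omega>)) * iexp (s * Y k \<omega> + b * (\<Sum>j\<in>J - insert k S. c j * Y j \<omega>)) \<partial>M)" for s b
        using insert.IH[of "\<lambda>j. if j = k then s else b * c j"] insert.prems unfolding split by simp
    qed (use k A X Y in \<open>auto intro!: prod_nonneg prod_le_1\<close>)
    then show ?case
      using insert.hyps by (simp add: mult.commute)
  qed
  have rect: "emeasure (distr M (\<Pi>\<^sub>M j\<in>J. borel) (\<lambda>\<omega>. \<lambda>j\<in>J. Z j \<omega>)) (Pi\<^sub>E J A) =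
      ennreal (\<integral>\<omega>. (\<Prod>j\<in>J. indicator (A j) (Z j \<omega>)) \<partial>M)"
    if [measurable]: "\<And>j. j \<in> J \<Longrightarrow> Z j \<in> borel_measurable M" for Z :: "'i \<Rightarrow> 'a \<Rightarrow> real"
  proof -
    let ?E = "{\<omega> \<in> space M. \<forall>j\<in>J. Z j \<omega> \<in> A j}"
    have E: "?E \<in> sets M"
      using A J by measurable
    have "emeasure (distr M (\<Pi>\<^sub>M j\<in>J. borel) (\<lambda>\<omega>. \<lambda>j\<in>J. Z j \<omega>)) (Pi\<^sub>E J A) =
        emeasure M ((\<lambda>\<omega>. \<lambda>j\<in>J. Z j \<omega>) -` (Pi\<^sub>E J A) \<inter> space M)"
      using A J by (intro emeasure_distr measurable_restrict sets_PiM_I_finite) auto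
    also have "(\<lambda>\<omega>. \<lambda>j\<in>J. Z j \<omega>) -` (Pi\<^sub>E J A) \<inter> space M = ?E"
      by (auto simp: PiE_iff)
    also have "emeasure M ?E = ennreal (\<integral>\<omega>. indicator ?E \<omega> \<partial>M)"
      using E by (simp add: emeasure_eq_measure)
    also have "(\<integral>\<omega>. indicator ?E \<omega> \<partial>M :: real) = (\<integral>\<omega>. (\<Prod>j\<in>J. indicator (A j) (Z j \<omega>)) \<partial>M)"
    proof (rule Bochner_Integration.integral_cong[OF refl])
      fix \<omega> assume "\<omega> \<in> space M"
      then show "indicator ?E \<omega> = (\<Prod>j\<in>J. indicator (A j) (Z j \<omega>) :: real)"
        using J by (auto simp: indicator_def prod_zero_iff)
    qed
    finally show ?thesis .
  qed
  have "complex_of_real (\<integral>\<omega>. (\<Prod>j\<in>J. indicator (A j) (X j \<omega>)) \<partial>M) =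
      complex_of_real (\<integral>\<omega>. (\<Prod>j\<in>J. indicator (A j) (Y j \<omega>)) \<partial>M)"
    using step[OF J, of "\<lambda>_. 0"] unfolding integral_complex_of_real[symmetric] by simp
  then have "(\<integral>\<omega>. (\<Prod>j\<in>J. indicator (A j) (X j \<omega>)) \<partial>M) = (\<integral>\<omega>. (\<Prod>j\<in>J. indicator (A j) (Y j \<omega>) :: real) \<partial>M)"
    by (rule of_real_eq_iff[THEN iffD1])
  then show "emeasure (distr M (\<Pi>\<^sub>M j\<in>J. borel) (\<lambda>\<omega>. \<lambda>j\<in>J. X j \<omega>)) (Pi\<^sub>E J A) =
      emeasure (distr M (\<Pi>\<^sub>M j\<in>J. borel) (\<lambda>\<omega>. \<lambda>j\<in>J. Y j \<omega>)) (Pi\<^sub>E J A)"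
    using rect[OF X] rect[OF Y] by simp
next
  \<comment> \<open>The measure is finite, so a constant sequence consisting of the whole space
    serves as exhaustion.\<close>
  show "range (\<lambda>_::nat. Pi\<^sub>E J (\<lambda>_. UNIV)) \<subseteq> prod_algebra J (\<lambda>_. borel :: real measure)"
    using J by (auto intro!: prod_algebraI_finite)
  show "(\<Union>i::nat. Pi\<^sub>E J (\<lambda>_. UNIV)) = space (\<Pi>\<^sub>M j\<in>J. (borel :: real measure))"
    by (simp add: space_PiM)
  have "finite_measure (distr M (\<Pi>\<^sub>M j\<in>J. borel) (\<lambda>\<omega>. \<lambda>j\<in>J. X j \<omega>))"
    by (intro finite_measure_distr measurable_restrict X)
  then show "emeasure (distr M (\<Pi>\<^sub>M j\<in>J. borel) (\<lambda>\<omega>. \<lambda>j\<in>J. X j \<omega>)) (Pi\<^sub>E J (\<lambda>_. UNIV)) \<noteq> \<infinity>" for i :: nat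
    by (simp add: finite_measure.emeasure_finite)
qed simp_all

text \<open>The characteristic function at 1 depends on the second moment only. The degenerate case
  is separate because it has no density; otherwise dividing by the standard deviation leads to the
  standard normal law.\<close>

lemma centered_gaussian_char:
  assumes "centered_gaussian M Z"
  shows "integrable M (\<lambda>\<omega>. (Z \<omega>)\<^sup>2)"
    and "(\<integral>\<omega>. iexp (Z \<omega>) \<partial>M) = complex_of_real (exp (- ((\<integral>\<omega>. (Z \<omega>)\<^sup>2 \<partial>M) / 2)))"
proof -
  have [measurable]: "Z \<in> borel_measurable M"
    and cases: "(AE \<omega> in M. Z \<omega> = 0) \<or> (\<exists>\<sigma>>0. distributed M lborel Z (normal_density 0 \<sigma>))"
    using assms by (auto simp: centered_gaussian_def)
  have "integrable M (\<lambda>\<omega>. (Z \<omega>)\<^sup>2) \<and>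
    (\<integral>\<omega>. iexp (Z \<omega>) \<partial>M) = complex_of_real (exp (- ((\<integral>\<omega>. (Z \<omega>)\<^sup>2 \<partial>M) / 2)))"
    using cases
  proof (elim disjE exE conjE)
    assume Z: "AE \<omega> in M. Z \<omega> = 0"
    have "integrable M (\<lambda>\<omega>. (Z \<omega>)\<^sup>2) \<longleftrightarrow> integrable M (\<lambda>\<omega>. 0 :: real)"
      by (rule integrable_cong_AE) (use Z in auto)
    moreover have "(\<integral>\<omega>. (Z \<omega>)\<^sup>2 \<partial>M) = (\<integral>\<omega>. 0 \<partial>M)"
      by (rule integral_cong_AE) (use Z in auto)
    moreover have "(\<integral>\<omega>. iexp (Z \<omega>) \<partial>M) = (\<integral>\<omega>. 1 \<partial>M)"
      by (rule integral_cong_AE) (use Z in auto)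
    ultimately show ?thesis
      by (simp add: prob_space)
  next
    fix \<sigma> :: real assume \<sigma>: "0 < \<sigma>" and D: "distributed M lborel Z (normal_density 0 \<sigma>)"
    have var: "(\<integral>\<omega>. (Z \<omega>)\<^sup>2 \<partial>M) = \<sigma>\<^sup>2"
      using normal_distributed_variance[OF \<sigma> D] normal_distributed_expectation[OF \<sigma> D] by simp
    \<comment> \<open>A non-integrable function has integral 0 by convention, so the positive value
      just found proves integrability.\<close>
    then have int: "integrable M (\<lambda>\<omega>. (Z \<omega>)\<^sup>2)"
      using \<sigma> not_integrable_integral_eq[of M "\<lambda>\<omega>. (Z \<omega>)\<^sup>2"] by fastforce
    have "distributed M lborel (\<lambda>\<omega>. Z \<omega> / \<sigma>) std_normal_density"
      using normal_standard_normal_convert[OF \<sigma>, of Z 0] D by simp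
    then have "distr M lborel (\<lambda>\<omega>. Z \<omega> / \<sigma>) = density lborel std_normal_density"
      by (rule distributed_distr_eq_density)
    then have "char (distr M lborel (\<lambda>\<omega>. Z \<omega> / \<sigma>)) \<sigma> = complex_of_real (exp (- (\<sigma>\<^sup>2) / 2))"
      using fun_cong[OF char_std_normal_distribution, of \<sigma>] by simp
    moreover have "char (distr M lborel (\<lambda>\<omega>. Z \<omega> / \<sigma>)) \<sigma> = (\<integral>\<omega>. iexp (\<sigma> * (Z \<omega> / \<sigma>)) \<partial>M)"
      unfolding char_def by (subst integral_distr) auto
    ultimately show ?thesis
      using int var \<sigma> by simp
  qed
  then show "integrable M (\<lambda>\<omega>. (Z \<omega>)\<^sup>2)"
    and "(\<integral>\<omega>. iexp (Z \<omega>) \<partial>M) = complex_of_real (exp (- ((\<integral>\<omega>. (Z \<omega>)\<^sup>2 \<partial>M) / 2)))"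
    by auto
qed

end

lemma integrable_mult_L2:
  assumes "f \<in> L2 M" "g \<in> L2 M"
  shows "integrable M (\<lambda>x. f x * g x)"
proof (rule Bochner_Integration.integrable_bound)
  show "integrable M (\<lambda>x. (f x)\<^sup>2 + (g x)\<^sup>2)"
    by (intro Bochner_Integration.integrable_add L2_integrable assms)
  show "(\<lambda>x. f x * g x) \<in> borel_measurable M"
    by (intro borel_measurable_times L2_measurable assms)
  have "\<bar>f x * g x\<bar> \<le> (f x)\<^sup>2 + (g x)\<^sup>2" for x
    using zero_le_power2[of "f x - g x"] zero_le_power2[of "f x + g x"]
    by (auto simp: abs_le_iff power2_eq_square algebra_simps)
  then show "AE x in M. norm (f x * g x) \<le> norm ((f x)\<^sup>2 + (g x)\<^sup>2)"
    by (auto intro: order_trans[OF _ abs_ge_self])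
qed

text \<open>Linear combinations are again centered Gaussian, so only their variance matters, and it
  expands into the covariances of the integrands.\<close>

lemma white_noise_char:
  assumes W: "white_noise M W" and J: "finite J" and F: "\<And>j. j \<in> J \<Longrightarrow> F j \<in> L2 spacetime"
  shows "(\<integral>\<omega>. iexp (\<Sum>j\<in>J. c j * W (F j) \<omega>) \<partial>M) =
    complex_of_real (exp (- ((\<Sum>i\<in>J. \<Sum>j\<in>J. c i * c j * (\<integral>p. F i p * F j p \<partial>spacetime)) / 2)))"
proof -
  have prob: "prob_space M"
    and gauss: "\<And>G c. finite G \<Longrightarrow> G \<subseteq> L2 spacetime \<Longrightarrow> centered_gaussian M (\<lambda>\<omega>. \<Sum>f\<in>G. c f * W f \<omega>)"
    and cov: "\<And>f g. f \<in> L2 spacetime \<Longrightarrow> g \<in> L2 spacetime \<Longrightarrow>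
        (\<integral>\<omega>. W f \<omega> * W g \<omega> \<partial>M) = (\<integral>p. f p * g p \<partial>spacetime)"
    using W unfolding white_noise_def by blast+
  interpret prob_space M by (rule prob)
  \<comment> \<open>\<open>white_noise\<close> speaks of combinations over sets of integrands,
    whereas \<open>F\<close> may take the same value at several indices; their coefficients are
    collected first.\<close>
  define d where "d f = (\<Sum>j\<in>{j \<in> J. F j = f}. c j)" for f
  have sum: "(\<Sum>f\<in>F ` J. d f * W f \<omega>) = (\<Sum>j\<in>J. c j * W (F j) \<omega>)" for \<omega>
  proof -
    have "(\<Sum>j\<in>J. c j * W (F j) \<omega>) = (\<Sum>f\<in>F ` J. \<Sum>j\<in>{j \<in> J. F j = f}. c j * W (F j) \<omega>)"
      by (rule sum.image_gen[OF J])
    then show ?thesis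
      by (simp add: d_def sum_distrib_right)
  qed
  have "centered_gaussian M (\<lambda>\<omega>. \<Sum>f\<in>F ` J. d f * W f \<omega>)"
    using J F by (intro gauss) auto
  then have Z: "centered_gaussian M (\<lambda>\<omega>. \<Sum>j\<in>J. c j * W (F j) \<omega>)"
    unfolding sum .
  have L2: "W f \<in> L2 M" if "f \<in> L2 spacetime" for f
  proof -
    have "centered_gaussian M (W f)"
      using gauss[of "{f}" "\<lambda>_. 1"] that by simp
    then show ?thesis
      using centered_gaussian_char(1)[of "W f"] by (simp add: L2_def centered_gaussian_def)
  qed
  have "(\<integral>\<omega>. (\<Sum>j\<in>J. c j * W (F j) \<omega>)\<^sup>2 \<partial>M) = (\<integral>\<omega>. (\<Sum>i\<in>J. \<Sum>j\<in>J. c i * c j * (W (F i) \<omega> * W (F j) \<omega>)) \<partial>M)"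
    by (simp add: power2_eq_square sum_product algebra_simps)
  also have "\<dots> = (\<Sum>i\<in>J. \<Sum>j\<in>J. c i * c j * (\<integral>\<omega>. W (F i) \<omega> * W (F j) \<omega> \<partial>M))"
    using L2 F by (simp add: Bochner_Integration.integral_sum integrable_mult_L2)
  also have "\<dots> = (\<Sum>i\<in>J. \<Sum>j\<in>J. c i * c j * (\<integral>p. F i p * F j p \<partial>spacetime))"
    using F by (intro sum.cong refl) (simp add: cov)
  finally show ?thesis
    using centered_gaussian_char(2)[OF Z] by simp
qed

section \<open>Rotation invariance of the Gaussian field\<close>

lemma sigma_finite_nonneg_times: "sigma_finite_measure (restrict_space lborel {0::real..})"
  by (rule sigma_finite_measure_restrict_space[OF sigma_finite_lborel]) simp

lemma measure_automorphism_spacetime_rot: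
  "measure_automorphism spacetime (\<lambda>p::real \<times> 'n::finite heis. (fst p, heis_rot \<theta> (snd p)))"
proof -
  note R = measure_automorphism_heis_rot[of \<theta>, where 'n = 'n]
  have eq: "distr lborel lborel (heis_rot \<theta> :: 'n heis \<Rightarrow> _) = lborel"
    using R by (simp add: measure_automorphism_def)
  have "distr (restrict_space lborel {0::real..}) (restrict_space lborel {0..}) (\<lambda>r. r) \<Otimes>\<^sub>M
      distr lborel lborel (heis_rot \<theta> :: 'n heis \<Rightarrow> _) =
      distr spacetime spacetime (\<lambda>(r, q). (r, heis_rot \<theta> q))"
    unfolding spacetime_def
    by (rule pair_measure_distr) (use measure_automorphism_measurable[OF R] in \<open>auto simp: eq sigma_finite_lborel\<close>)
  then have "distr spacetime spacetime (\<lambda>(r, q). (r, heis_rot \<theta> q)) = (spacetime :: (real \<times> 'n heis) measure)"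
    by (simp add: eq distr_id spacetime_def)
  moreover have "(\<lambda>p. (fst p, heis_rot \<theta> (snd p))) \<in> measurable spacetime (spacetime :: (real \<times> 'n heis) measure)"
    unfolding spacetime_def
    by (intro measurable_Pair measurable_fst measurable_compose[OF measurable_snd measure_automorphism_measurable[OF R]])
  ultimately show ?thesis
    by (simp add: measure_automorphism_def case_prod_beta')
qed

definition W_integrand ::
    "(real \<Rightarrow> 'n::finite heis \<Rightarrow> real) \<Rightarrow> real \<Rightarrow> real \<Rightarrow> 'n heis \<Rightarrow> real \<times> 'n heis \<Rightarrow> real" where
  "W_integrand h \<alpha> t x = (\<lambda>(r, q). indicator {0..t} r * (G_kernel h \<alpha> x q - G_kernel h \<alpha> heis_e q))"

lemma W_integrand_measurable:
  fixes h :: "real \<Rightarrow> 'n::finite heis \<Rightarrow> real"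
  assumes "heat_kernel h"
  shows "W_integrand h \<alpha> t x \<in> borel_measurable spacetime"
proof -
  have [measurable]: "G_kernel h \<alpha> y \<in> borel_measurable lborel" for y
    by (rule G_kernel_measurable[OF assms])
  have [measurable]: "(indicator {0..t} :: real \<Rightarrow> real) \<in> borel_measurable (restrict_space lborel {0..})"
    by (intro measurable_restrict_space1) simp
  show ?thesis
    unfolding W_integrand_def spacetime_def by measurable
qed

text \<open>The rotation fixes the identity, so the subtracted kernel at \<open>heis_e\<close> is
  invariant for the same reason as the kernel at \<open>x\<close>.\<close>

lemma W_integrand_rot:
  fixes h :: "real \<Rightarrow> 'n::finite heis \<Rightarrow> real"
  assumes h: "heat_kernel h"
  shows "AE p in spacetime. W_integrand h \<alpha> t (heis_rot \<theta> x) (fst p, heis_rot \<theta> (snd p)) = W_integrand h \<alpha> t x p"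
    (is "AE p in _. ?L p = ?R p")
proof -
  interpret pair_sigma_finite "restrict_space lborel {0::real..}" "lborel :: 'n heis measure"
    by (intro pair_sigma_finite.intro sigma_finite_nonneg_times sigma_finite_lborel)
  have "AE q in lborel. ?L (r, q) = ?R (r, q)" for r
    using G_kernel_rot[OF h, of \<alpha> \<theta> x] G_kernel_rot[OF h, of \<alpha> \<theta> heis_e]
    by eventually_elim (simp add: W_integrand_def heis_rot_e)
  moreover have "{p \<in> space spacetime. ?L p = ?R p} \<in> sets spacetime"
    using measurable_compose[OF measure_automorphism_measurable[OF measure_automorphism_spacetime_rot] W_integrand_measurable[OF h]]
      W_integrand_measurable[OF h]
    by (rule borel_measurable_eq)
  ultimately show ?thesis
    unfolding spacetime_def by (intro AE_pair_measure) auto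
qed

text \<open>This ensures that the conventional value 0 of \<open>wiener_integral\<close> occurs for
  the rotated field at exactly the same indices as for the original one.\<close>

lemma W_integrand_rot_L2:
  assumes h: "heat_kernel h"
  shows "W_integrand h \<alpha> t (heis_rot \<theta> x) \<in> L2 spacetime \<longleftrightarrow> W_integrand h \<alpha> t x \<in> L2 spacetime"
proof -
  note \<Psi> = measure_automorphism_spacetime_rot[of \<theta>]
  note meas = W_integrand_measurable[OF h]
  note meas' = measurable_compose[OF measure_automorphism_measurable[OF \<Psi>] meas]
  have "integrable spacetime (\<lambda>p. (W_integrand h \<alpha> t (heis_rot \<theta> x) p)\<^sup>2) \<longleftrightarrow>
      integrable spacetime (\<lambda>p. (W_integrand h \<alpha> t (heis_rot \<theta> x) (fst p, heis_rot \<theta> (snd p)))\<^sup>2)"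
    by (rule measure_automorphism_integrable[OF \<Psi> borel_measurable_power[OF meas], symmetric])
  also have "\<dots> \<longleftrightarrow> integrable spacetime (\<lambda>p. (W_integrand h \<alpha> t x p)\<^sup>2)"
    by (rule integrable_cong_AE[OF borel_measurable_power[OF meas'] borel_measurable_power[OF meas]])
      (use W_integrand_rot[OF h, of \<alpha> t \<theta> x] in eventually_elim, simp)
  finally show ?thesis
    by (simp add: L2_def meas)
qed

lemma W_integrand_rot_covariance:
  assumes h: "heat_kernel h"
  shows "(\<integral>p. W_integrand h \<alpha> s (heis_rot \<theta> x) p * W_integrand h \<alpha> t (heis_rot \<theta> y) p \<partial>spacetime) =
    (\<integral>p. W_integrand h \<alpha> s x p * W_integrand h \<alpha> t y p \<partial>spacetime)"
proof -
  note \<Psi> = measure_automorphism_spacetime_rot[of \<theta>]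
  note meas = W_integrand_measurable[OF h]
  note meas' = measurable_compose[OF measure_automorphism_measurable[OF \<Psi>] meas]
  have "(\<integral>p. W_integrand h \<alpha> s (heis_rot \<theta> x) p * W_integrand h \<alpha> t (heis_rot \<theta> y) p \<partial>spacetime) =
      (\<integral>p. W_integrand h \<alpha> s (heis_rot \<theta> x) (fst p, heis_rot \<theta> (snd p))
        * W_integrand h \<alpha> t (heis_rot \<theta> y) (fst p, heis_rot \<theta> (snd p)) \<partial>spacetime)"
    by (rule measure_automorphism_integral[OF \<Psi> borel_measurable_times[OF meas meas], symmetric])
  also have "\<dots> = (\<integral>p. W_integrand h \<alpha> s x p * W_integrand h \<alpha> t y p \<partial>spacetime)"
    by (rule integral_cong_AE[OF borel_measurable_times[OF meas' meas'] borel_measurable_times[OF meas meas]])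
      (use W_integrand_rot[OF h, of \<alpha> s \<theta> x] W_integrand_rot[OF h, of \<alpha> t \<theta> y] in eventually_elim, simp)
  finally show ?thesis .
qed

lemma W_field_eq:
  "W_field h W \<alpha> t x = (if W_integrand h \<alpha> t x \<in> L2 spacetime then W (W_integrand h \<alpha> t x) else (\<lambda>_. 0))"
  by (simp add: W_field_def W_integrand_def wiener_integral_def)

theorem proposition3p14:
  fixes h :: "real \<Rightarrow> 'n::finite heis \<Rightarrow> real"
    and M :: "'w measure"
    and W :: "(real \<times> 'n heis \<Rightarrow> real) \<Rightarrow> 'w \<Rightarrow> real"
    and \<alpha> \<theta> :: real
  assumes "heat_kernel h"
    and "white_noise M W"
    and "real CARD('n) / 2 + 1 / 2 < \<alpha>" and "\<alpha> < real CARD('n) / 2 + 1"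
    and "0 \<le> \<theta>" and "\<theta> < 2 * pi"
  shows "equal_in_law M ({0..} \<times> UNIV)
           (\<lambda>(t, x). W_field h W \<alpha> t (heis_rot \<theta> x))
           (\<lambda>(t, x). W_field h W \<alpha> t x)"
proof -
  note h = assms(1) and W = assms(2)
  interpret prob_space M
    using W by (simp add: white_noise_def)
  define F where "F j = W_integrand h \<alpha> (fst j) (snd j)" for j :: "real \<times> 'n heis"
  define F' where "F' j = W_integrand h \<alpha> (fst j) (heis_rot \<theta> (snd j))" for j :: "real \<times> 'n heis"
  define X where "X j = W_field h W \<alpha> (fst j) (snd j)" for j :: "real \<times> 'n heis"
  define X' where "X' j = W_field h W \<alpha> (fst j) (heis_rot \<theta> (snd j))" for j :: "real \<times> 'n heis"
  have "distr M (\<Pi>\<^sub>M j\<in>J. borel) (\<lambda>\<omega>. \<lambda>j\<in>J. X' j \<omega>) = distr M (\<Pi>\<^sub>M j\<in>J. borel) (\<lambda>\<omega>. \<lambda>j\<in>J. X j \<omega>)"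
    if J: "finite J" for J
  proof (rule law_eq_if_char_eq[OF J])
    show "X' j \<in> borel_measurable M" "X j \<in> borel_measurable M" for j
      unfolding X_def X'_def by (rule W_field_measurable[OF W])+
  next
    fix c :: "real \<times> 'n heis \<Rightarrow> real"
    \<comment> \<open>The indices with a genuine stochastic integral; by \<open>L'\<close> they are
      the same for both fields, and all other summands are 0 on both sides.\<close>
    define L where "L = {j \<in> J. F j \<in> L2 spacetime}"
    have L': "L = {j \<in> J. F' j \<in> L2 spacetime}"
      by (simp add: L_def F_def F'_def W_integrand_rot_L2[OF h])
    have L: "finite L" "L \<subseteq> J" and F: "\<And>j. j \<in> L \<Longrightarrow> F j \<in> L2 spacetime"
      using J by (auto simp: L_def)
    have F': "\<And>j. j \<in> L \<Longrightarrow> F' j \<in> L2 spacetime"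
      by (simp add: L')
    have X: "X j = (if F j \<in> L2 spacetime then W (F j) else (\<lambda>_. 0))"
      and X': "X' j = (if F' j \<in> L2 spacetime then W (F' j) else (\<lambda>_. 0))" for j
      by (simp_all add: X_def X'_def F_def F'_def W_field_eq)
    have "(\<Sum>j\<in>J. c j * X' j \<omega>) = (\<Sum>j\<in>L. c j * W (F' j) \<omega>)" for \<omega>
      using J by (intro sum.mono_neutral_cong_right) (auto simp: L' X')
    moreover have "(\<Sum>j\<in>J. c j * X j \<omega>) = (\<Sum>j\<in>L. c j * W (F j) \<omega>)" for \<omega>
      using J by (intro sum.mono_neutral_cong_right) (auto simp: L_def X)
    moreover have "(\<integral>p. F' i p * F' j p \<partial>spacetime) = (\<integral>p. F i p * F j p \<partial>spacetime)" for i j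
      unfolding F_def F'_def by (rule W_integrand_rot_covariance[OF h])
    ultimately show "(\<integral>\<omega>. iexp (\<Sum>j\<in>J. c j * X' j \<omega>) \<partial>M) = (\<integral>\<omega>. iexp (\<Sum>j\<in>J. c j * X j \<omega>) \<partial>M)"
      using white_noise_char[OF W L(1) F', where c = c] white_noise_char[OF W L(1) F, where c = c] by simp
  qed
  then show ?thesis
    by (simp add: equal_in_law_def X_def X'_def case_prod_beta')
qed

end
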